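(* For $i,j\ge0$ define $$d_{i,j}=\begin{cases}5I+J,&(i,j)=(2I,2J),\\ 5I+J+1,&(i,j)=(2I,2J+1),\\ 5I+J+3,&(i,j)=(2I+1,2J),\\ 5I+J+3,&(i,j)=(2I+1,2J+1).\end{cases}$$ Then for all $i,j\ge0$ and all $m$ with $0\le m<d_{i,j}$, $Z_{i,j}(m)=0$; furthermore $Z_{i,j}(d_{i,j})$ is an odd integer.
   Context: Let $E(q)=\prod_{m\ge1}(1-q^m)$. Define $$\gamma(q)=\frac{E(q)^5E(q^2)^5E(q^6)^5}{E(q^3)^{15}},\quad \xi=\xi(q)=\frac{E(q^2)^5E(q^6)}{E(q)E(q^3)^5},\quad \kappa(q)=\frac{\gamma(q^2)^2}{\gamma(q)},$$ and let $U\left(\sum_n a_nq^n\right)=\sum_n a_{2n}q^n$. For $i,j\ge0$, $\zeta_{i,j}=U(\kappa^i\xi^j)$; it is known that $\zeta_{i,j}$ equals a polynomial in $\xi$ with integer coefficients, and $Z_{i,j}(m)$ ($m\ge0$) denote its coefficients: $\zeta_{i,j}=\sum_m Z_{i,j}(m)\xi^m$. *)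

theory Defs
  imports "HOL-Computational_Algebra.Computational_Algebra"
begin

text \<open>E(q^k) = prod_{m>=1} (1 - q^(k m)) as a formal power series over the rationals;
  the n-th coefficient is taken from the finite product over m = 1..n, which
  already determines it.\<close>
definition Eq :: "nat \<Rightarrow> rat fps" where
  "Eq k = Abs_fps (\<lambda>n. (\<Prod>m\<in>{1..n}. (1 - fps_X ^ (k * m) :: rat fps)) $ n)"

definition gam :: "nat \<Rightarrow> rat fps" where
  "gam k = (Eq k ^ 5 * Eq (2*k) ^ 5 * Eq (6*k) ^ 5) / Eq (3*k) ^ 15"

definition xi :: "rat fps" where
  "xi = (Eq 2 ^ 5 * Eq 6) / (Eq 1 * Eq 3 ^ 5)"

definition kappa :: "rat fps" where
  "kappa = gam 2 ^ 2 / gam 1"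

definition U :: "rat fps \<Rightarrow> rat fps" where
  "U f = Abs_fps (\<lambda>n. f $ (2 * n))"

definition zeta :: "nat \<Rightarrow> nat \<Rightarrow> rat fps" where
  "zeta i j = U (kappa ^ i * xi ^ j)"

definition poly_at_xi :: "int poly \<Rightarrow> rat fps" where
  "poly_at_xi P = poly (map_poly (\<lambda>c. fps_const (of_int c)) P) xi"

definition Z :: "nat \<Rightarrow> nat \<Rightarrow> nat \<Rightarrow> int" where
  "Z i j m = coeff (THE P. zeta i j = poly_at_xi P) m"

definition d :: "nat \<Rightarrow> nat \<Rightarrow> nat" where
  "d i j = (let I = i div 2; J = j div 2 in
     if even i then (if even j then 5*I + J else 5*I + J + 1) else 5*I + J + 3)"

end

theory Submission
  imports Defs
begin

text \<open>
  Write \<open>x = \<xi>(q\<^sup>2)\<close> and denote the substitution of \<open>-q\<close> for \<open>q\<close> by a prime. Splitting the theta series of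
  \<open>\<psi>(q) = E\<^sub>2\<^sup>2/E\<^sub>1\<close> and \<open>\<phi>(-q) = E\<^sub>1\<^sup>2/E\<^sub>2\<close> according to the summation index modulo 3, and taking the product over the
  substitutions \<open>q \<mapsto> \<omega>q\<close> with \<open>\<omega>\<^sup>3 = 1\<close>, shows that \<open>\<xi> - 1\<close> and \<open>9 - 8\<xi>\<close> are eta quotients. Hence so are the products
  \<open>\<xi> \<xi>' = x (9 - 8x)\<close> and \<open>(\<xi> - 1) (\<xi>' - 1) = 1 - x\<close>, which give \<open>\<xi> + \<xi>' = 10x - 8x\<^sup>2\<close>: this is the modular equation of \<open>\<xi>\<close>.
  Its discriminant is \<open>4 (4x - 3)\<^sup>2 (x\<^sup>2 - x)\<close>, so the curve is rational; it is parametrized by an eta quotient \<open>h\<close> with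
  \<open>h + h' = 2x\<close>, \<open>h h' = x\<close>, and \<open>\<kappa> = h\<^sup>5\<close>. Consequently \<open>\<kappa>\<close> and \<open>\<xi>\<close> both satisfy quadratic equations over the even series, and
  \<open>\<zeta>\<^sub>i\<^sub>,\<^sub>j\<close> satisfies two-term recurrences in \<open>i\<close> and in \<open>j\<close>. In both of them the middle coefficient is even and the last one is
  \<open>\<xi>\<^sup>5\<close> respectively \<open>\<xi> (9 - 8\<xi>)\<close>, so that each step shifts the lowest exponent by 5 respectively 1 and keeps the lowest
  coefficient odd.
\<close>

section \<open>Convergence of formal power series\<close>

lemma fps_X_power_dvd_iff:
  fixes f :: "'a::field fps"
  shows "fps_X ^ n dvd f \<longleftrightarrow> (\<forall>i<n. f $ i = 0)"
proof
  assume "fps_X ^ n dvd f"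
  then obtain g where "f = fps_X ^ n * g" by (elim dvdE)
  then show "\<forall>i<n. f $ i = 0" by (simp add: fps_X_power_mult_nth)
next
  assume *: "\<forall>i<n. f $ i = 0"
  show "fps_X ^ n dvd f"
  proof
    show "f = fps_X ^ n * fps_shift n f"
      by (rule fps_ext) (use * in \<open>auto simp: fps_X_power_mult_nth\<close>)
  qed
qed

text \<open>Convergence of power series means that every coefficient is eventually constant, and a
  coefficient of a product involves only finitely many coefficients of the factors.\<close>

lemma tendsto_mult_fps:
  fixes f g :: "'b \<Rightarrow> 'a::field fps"
  assumes "(f \<longlongrightarrow> a) F" "(g \<longlongrightarrow> b) F"
  shows "((\<lambda>x. f x * g x) \<longlongrightarrow> a * b) F"
proof (rule tendsto_fpsI)
  fix n
  have "\<forall>\<^sub>F x in F. \<forall>i\<in>{..n}. f x $ i = a $ i" "\<forall>\<^sub>F x in F. \<forall>i\<in>{..n}. g x $ i = b $ i"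
    using assms by (auto simp: tendsto_fps_iff intro!: eventually_ball_finite)
  then show "\<forall>\<^sub>F x in F. (f x * g x) $ n = (a * b) $ n"
    by eventually_elim (simp add: fps_mult_nth)
qed

lemma tendsto_power_fps:
  fixes f :: "'b \<Rightarrow> 'a::field fps"
  assumes "(f \<longlongrightarrow> a) F"
  shows "((\<lambda>x. f x ^ n) \<longlongrightarrow> a ^ n) F"
  by (induction n) (auto intro: tendsto_mult_fps assms)

lemma tendsto_add_fps:
  fixes f g :: "'b \<Rightarrow> 'a::field fps"
  assumes "(f \<longlongrightarrow> a) F" "(g \<longlongrightarrow> b) F"
  shows "((\<lambda>x. f x + g x) \<longlongrightarrow> a + b) F"
proof (rule tendsto_fpsI)
  fix n
  have "\<forall>\<^sub>F x in F. f x $ n = a $ n" "\<forall>\<^sub>F x in F. g x $ n = b $ n"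
    using assms by (auto simp: tendsto_fps_iff)
  then show "\<forall>\<^sub>F x in F. (f x + g x) $ n = (a + b) $ n"
    by eventually_elim simp
qed

section \<open>Euler products\<close>

definition fprod :: "nat \<Rightarrow> nat \<Rightarrow> 'a::field fps" where
  "fprod k n = (\<Prod>m\<in>{1..n}. 1 - fps_X ^ (k * m))"

text \<open>\<open>Eq\<close> over an arbitrary field; the complex numbers are needed for the cube roots of unity.\<close>

definition eul :: "nat \<Rightarrow> 'a::field fps" where
  "eul k = Abs_fps (\<lambda>n. fprod k n $ n)"

lemma Eq_eq_eul: "Eq = eul"
  by (simp add: fun_eq_iff Eq_def eul_def fprod_def)

lemma fprod_0 [simp]: "fprod k 0 = 1"
  by (simp add: fprod_def)

lemma fprod_Suc: "fprod k (Suc n) = fprod k n * (1 - fps_X ^ (k * Suc n))"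
  by (simp add: fprod_def)

lemma fprod_nth_0 [simp]: "k > 0 \<Longrightarrow> fprod k n $ 0 = 1"
  by (induction n) (auto simp: fprod_Suc)

text \<open>Each further factor is 1 minus a power of \<open>fps_X\<close> with exponent above
  \<open>j\<close>, so it cannot change the coefficient at \<open>j\<close>.\<close>

lemma fprod_nth_stable:
  assumes "k > 0" "j \<le> n" "n \<le> m"
  shows "fprod k m $ j = fprod k n $ j"
  using assms(3)
proof (induction rule: dec_induct)
  case (step m)
  have "j < k * Suc m" using assms step.hyps by (cases k) auto
  then have "(fprod k m * fps_X ^ (k * Suc m)) $ j = 0"
    by (simp only: fps_X_power_mult_right_nth if_True)
  then show ?case using step.IH by (simp add: fprod_Suc ring_distribs del: mult_Suc_right)
qed simp

lemma eul_nth: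
  assumes "k > 0" "j \<le> n"
  shows "eul k $ j = (fprod k n :: 'a::field fps) $ j"
  using fprod_nth_stable[of k j j n, where 'a='a] assms by (simp add: eul_def)

lemma eul_nth_0 [simp]: "k > 0 \<Longrightarrow> eul k $ 0 = 1"
  by (simp add: eul_def)

lemma eul_nonzero [simp]: "k > 0 \<Longrightarrow> eul k \<noteq> 0"
  by (metis eul_nth_0 fps_zero_nth zero_neq_one)

text \<open>A quantitative form of convergence, needed for the error estimate in the triple
  product.\<close>

lemma fprod_dvd: "k > 0 \<Longrightarrow> fps_X ^ Suc n dvd fprod k n - eul k"
  by (subst fps_X_power_dvd_iff) (auto simp: eul_nth[of k _ n])

lemma fprod_tendsto: "k > 0 \<Longrightarrow> fprod k \<longlonglongrightarrow> eul k"
proof (rule tendsto_fpsI)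
  fix n assume "k > 0"
  show "\<forall>\<^sub>F N in sequentially. fprod k N $ n = eul k $ n"
    using eventually_ge_at_top[of n] by eventually_elim (use \<open>k > 0\<close> in \<open>simp add: eul_nth\<close>)
qed

lemma fprod_tendsto_subseq: 
  assumes "k > 0" "c > 0"
  shows "(\<lambda>n. fprod k (c * n)) \<longlonglongrightarrow> eul k"
proof -
  have "filterlim (\<lambda>n. c * n) at_top at_top"
    using assms(2) by (auto intro!: filterlim_subseq simp: strict_mono_def)
  from filterlim_compose[OF fprod_tendsto[OF assms(1)] this] show ?thesis .
qed

section \<open>The Jacobi triple product\<close>

definition inv_fprod :: "nat \<Rightarrow> int \<Rightarrow> 'a::field fps" where
  "inv_fprod b n = (if n < 0 then 0 else inverse (fprod b (nat n)))"

text \<open>At \<open>n = -1\<close> the factor is \<open>1 - fps_X ^ 0 = 0\<close>, in agreement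
  with the value 0 at negative arguments; this is why the recurrence reaches one step below
  0.\<close>

lemma inv_fprod_rec:
  assumes "b > 0" "n \<ge> -1"
  shows "inv_fprod b n = (1 - fps_X ^ (b * nat (n + 1))) * inv_fprod b (n + 1)"
proof (cases "n = -1")
  case False
  then have n: "n \<ge> 0" using assms by simp
  then have eq: "nat (n + 1) = Suc (nat n)" by simp
  have "(1 - fps_X ^ (b * Suc (nat n)) :: 'a fps) $ 0 = 1"
    using assms(1) by simp
  then have "(1 - fps_X ^ (b * Suc (nat n))) * inverse (1 - fps_X ^ (b * Suc (nat n))) = (1 :: 'a fps)"
    by (intro inverse_mult_eq_1') simp
  then show ?thesis using n
    by (simp only: inv_fprod_def eq fprod_Suc fps_inverse_mult) (simp add: mult_ac)
qed (simp add: inv_fprod_def)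

text \<open>The Gaussian binomial coefficient \<open>2N\<close> over \<open>N + k\<close> in base \<open>q\<^sup>b\<close>. The convention that \<open>inv_fprod\<close> vanishes at
  negative arguments makes its recurrence hold without case distinctions at \<open>\<bar>k\<bar> = N\<close>.\<close>

definition gbinom :: "nat \<Rightarrow> nat \<Rightarrow> int \<Rightarrow> 'a::field fps" where
  "gbinom b N k = fprod b (2 * N) * inv_fprod b (int N - k) * inv_fprod b (int N + k)"

lemma gbinom_eq_0: "\<bar>k\<bar> > int N \<Longrightarrow> gbinom b N k = 0"
  by (auto simp: gbinom_def inv_fprod_def)

text \<open>Two q-Pascal steps at once, from row 2N to row 2N + 2. The three terms match those that
  arise when the sum in the finite triple product is multiplied by its two new factors.\<close>

lemma gbinom_Suc:
  assumes b: "b > 0" and k: "\<bar>k\<bar> \<le> int N + 1"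
  shows "gbinom b (Suc N) k = (1 + fps_X ^ (b * (2*N+1))) * gbinom b N k
     + fps_X ^ (b * nat (int N + 1 - k)) * gbinom b N (k - 1)
     + fps_X ^ (b * nat (int N + 1 + k)) * (gbinom b N (k + 1) :: 'a::field fps)"
proof -
  define Q w :: "'a fps" where "Q = fps_X ^ b" and "w = fps_X ^ (b * (2*N+1))"
  define u v :: "'a fps" where "u = fps_X ^ (b * nat (int N + 1 - k))" and "v = fps_X ^ (b * nat (int N + 1 + k))"
  define u1 v1 :: "'a fps" where "u1 = fps_X ^ (b * nat (int N - k))" and "v1 = fps_X ^ (b * nat (int N + k))"
  define f gm gp :: "'a fps" where "f = fprod b (2*N)" and "gm = inv_fprod b (int N + 1 - k)" and "gp = inv_fprod b (int N + 1 + k)"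
  have sh: "int N - k + 1 = int N + 1 - k" "int N + k + 1 = int N + 1 + k"
    "int N - 1 - k + 1 = int N - k" "int N - 1 + k + 1 = int N + k" by simp_all
  have eq1: "inv_fprod b (int N - k) = (1 - u) * gm"
    using inv_fprod_rec[OF b, of "int N - k", where 'a='a] k unfolding u_def gm_def sh by simp
  have eq2: "inv_fprod b (int N + k) = (1 - v) * gp"
    using inv_fprod_rec[OF b, of "int N + k", where 'a='a] k unfolding v_def gp_def sh by simp
  have eq3: "inv_fprod b (int N - 1 - k) = (1 - u1) * (1 - u) * gm" if "k \<le> int N"
    using inv_fprod_rec[OF b, of "int N - 1 - k", where 'a='a] that k eq1 unfolding u1_def sh by simp
  \<comment> \<open>The argument is -2 here, outside the range of \<open>inv_fprod_rec\<close>, so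
    the value comes from the definition.\<close>
  have eq3': "inv_fprod b (int N - 1 - k) = (0::'a fps)" if "k = int N + 1"
    using that by (simp add: inv_fprod_def)
  have eq4: "inv_fprod b (int N - 1 + k) = (1 - v1) * (1 - v) * gp" if "k \<ge> - int N"
    using inv_fprod_rec[OF b, of "int N - 1 + k", where 'a='a] that k eq2 unfolding v1_def sh by simp
  have eq4': "inv_fprod b (int N - 1 + k) = (0::'a fps)" if "k = - int N - 1"
    using that by (simp add: inv_fprod_def)
  have f2: "fprod b (2 * Suc N) = f * (1 - w) * (1 - Q * w)"
  proof -
    have n: "2 * Suc N = Suc (Suc (2 * N))" "b * Suc (2 * N) = b * (2 * N + 1)"
      "b * Suc (Suc (2 * N)) = b + b * (2 * N + 1)" by simp_all
    show ?thesis
      by (simp only: n fprod_Suc power_add f_def w_def Q_def)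
  qed
  have main: "f * (1 - w) * (1 - Q * w) * gm * gp = (1 + w) * (f * ((1 - u) * gm) * ((1 - v) * gp))
     + u * (f * gm * inv_fprod b (int N - 1 + k)) + v * (f * inv_fprod b (int N - 1 - k) * gp)"
  proof -
    \<comment> \<open>At the two ends \<open>nat\<close> truncates an exponent to 0, so that
      \<open>u = Q * u1\<close> or \<open>v = Q * v1\<close> fails; only the inner case is
      uniform.\<close>
    consider "k = int N + 1" | "k = - int N - 1" | "\<bar>k\<bar> \<le> int N" using k by linarith
    then show ?thesis
    proof cases
      case 1
      have n: "nat (int N + 1 - k) = 0" "nat (int N + k) = 2 * N + 1"
        "nat (int N + 1 + k) = 1 + (2 * N + 1)"
        using 1 by linarith+
      have "u = 1" "v = Q * w" "v1 = w"
        unfolding u_def v_def v1_def Q_def w_def n distrib_left power_add by simp_all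
      moreover have "inv_fprod b (int N - 1 + k) = (1 - v1) * (1 - v) * gp" "inv_fprod b (int N - 1 - k) = (0 :: 'a fps)"
        using 1 eq4 eq3' by simp_all
      ultimately show ?thesis by (simp only:) (simp add: algebra_simps)
    next
      case 2
      have n: "nat (int N + 1 + k) = 0" "nat (int N - k) = 2 * N + 1"
        "nat (int N + 1 - k) = 1 + (2 * N + 1)"
        using 2 by linarith+
      have "v = 1" "u = Q * w" "u1 = w"
        unfolding u_def v_def u1_def Q_def w_def n distrib_left power_add by simp_all
      moreover have "inv_fprod b (int N - 1 - k) = (1 - u1) * (1 - u) * gm" "inv_fprod b (int N - 1 + k) = (0 :: 'a fps)"
        using 2 eq3 eq4' by simp_all
      ultimately show ?thesis by (simp only:) (simp add: algebra_simps)
    next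
      case 3
      have n: "nat (int N + 1 - k) = Suc (nat (int N - k))" "nat (int N + 1 + k) = Suc (nat (int N + k))"
        "2 * N = nat (int N - k) + nat (int N + k)"
        using 3 by auto
      have "u = Q * u1" "v = Q * v1" "w = Q * u1 * v1"
        unfolding u_def v_def u1_def v1_def Q_def w_def n by (simp_all add: power_add algebra_simps)
      \<comment> \<open>The recurrence with the common factor \<open>f * gm * gp\<close> removed, as
        an identity of polynomials in \<open>Q\<close>, \<open>u1\<close>,
        \<open>v1\<close>.\<close>
      moreover have "(1 - Q*u1*v1) * (1 - Q*(Q*u1*v1)) = (1 + Q*u1*v1) * (1-Q*u1) * (1-Q*v1) + Q*u1 * (1-Q*v1) * (1-v1) + Q*v1 * (1-Q*u1) * (1-u1)"
        by (simp add: algebra_simps)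
      ultimately have "(1 - w) * (1 - Q * w) = (1 + w) * (1 - u) * (1 - v) + u * (1 - v) * (1 - v1) + v * (1 - u) * (1 - u1)"
        by simp
      then have m: "f * gm * gp * ((1 - w) * (1 - Q * w)) = f * gm * gp * ((1 + w) * (1 - u) * (1 - v) + u * (1 - v) * (1 - v1) + v * (1 - u) * (1 - u1))"
        by simp
      have "inv_fprod b (int N - 1 + k) = (1 - v1) * (1 - v) * gp" "inv_fprod b (int N - 1 - k) = (1 - u1) * (1 - u) * gm"
        using 3 eq3 eq4 by simp_all
      moreover have "f * (1 - w) * (1 - Q * w) * gm * gp = f * gm * gp * ((1 - w) * (1 - Q * w))"
        by (simp only: mult_ac)
      ultimately show ?thesis unfolding m by (simp only: distrib_left mult_ac)
    qed
  qed
  have "gbinom b (Suc N) k = f * (1 - w) * (1 - Q * w) * gm * gp"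
    by (simp only: gbinom_def f2) (simp add: gm_def gp_def algebra_simps)
  moreover have "gbinom b N k = f * ((1 - u) * gm) * ((1 - v) * gp)"
    by (simp only: gbinom_def eq1 eq2 f_def)
  moreover have "gbinom b N (k - 1) = f * gm * inv_fprod b (int N - 1 + k)"
    by (simp add: gbinom_def f_def gm_def algebra_simps)
  moreover have "gbinom b N (k + 1) = f * inv_fprod b (int N - 1 - k) * gp"
    by (simp add: gbinom_def f_def gp_def algebra_simps)
  ultimately show ?thesis using main by (simp only: u_def v_def w_def)
qed

section \<open>Theta exponents and the finite triple product\<close>

definition jexp :: "nat \<Rightarrow> nat \<Rightarrow> int \<Rightarrow> nat" where
  "jexp b a k = nat (int a * k + int b * (k * (k - 1) div 2))"

text \<open>Nonnegativity makes the \<open>nat\<close> in \<open>jexp\<close> harmless; the linear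
  growth compensates for the loss of precision in \<open>gbinom_dvd\<close> at large
  \<open>\<bar>k\<bar>\<close>. For \<open>k \<le> 0\<close> the bound reduces to (k + 1)(k + 2)
  \<ge> 0.\<close>

lemma jexp_ge:
  assumes "0 < a" "a \<le> b"
  shows "int a * k + int b * (k * (k - 1) div 2) \<ge> \<bar>k\<bar> - 1" (is ?A)
    and "int a * k + int b * (k * (k - 1) div 2) \<ge> 0" (is ?B)
proof -
  define t where "t = k * (k - 1) div 2"
  have t: "2 * t = k * (k - 1)" by (simp add: t_def)
  have *: "?A \<and> ?B"
  proof (cases "k \<ge> 1")
    case True
    have "k * (k - 1) \<ge> 0" using True by simp
    then have "t \<ge> 0" using t by simp
    moreover have "int a * k \<ge> 1 * k" using True assms by (intro mult_right_mono) auto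
    moreover have "int b * t \<ge> 0" using \<open>t \<ge> 0\<close> by simp
    ultimately show ?thesis using True unfolding t_def[symmetric] by linarith
  next
    case False
    have "(k + 1) * k \<ge> 0" using False by (cases "k = 0") (auto intro: mult_nonpos_nonpos)
    then have s: "t + k \<ge> 0" using t by (simp add: algebra_simps)
    have "(-k - 1) * (-k - 2) \<ge> 0"
      using False by (cases "k = 0"; cases "k = -1") auto
    then have s2: "t + k \<ge> -k - 1" using t by (simp add: algebra_simps)
    have t0: "t \<ge> 0" using s False by simp
    have "int a * k + int b * t \<ge> int a * k + int a * t"
      using assms t0 by (simp add: mult_right_mono)
    moreover have "int a * (k + t) \<ge> 1 * (k + t)" using s assms by (intro mult_right_mono) auto
    ultimately show ?thesis using False s s2 unfolding t_def[symmetric] distrib_left by linarith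
  qed
  then show ?A ?B by auto
qed

lemma int_jexp:
  "0 < a \<Longrightarrow> a \<le> b \<Longrightarrow> int (jexp b a k) = int a * k + int b * (k * (k - 1) div 2)"
  using jexp_ge(2)[of a b k] by (simp add: jexp_def)

lemma triangle_Suc: "(k + 1) * k div 2 = k * (k - 1) div 2 + (k::int)"
proof -
  have "(k + 1) * k = k * (k - 1) + k * 2" by (simp add: algebra_simps)
  then show ?thesis by simp
qed

lemma jexp_add1:
  assumes "0 < a" "a \<le> b"
  shows "int (jexp b a (k + 1)) = int (jexp b a k) + int a + int b * k"
  using assms triangle_Suc[of k] by (simp add: int_jexp algebra_simps)

text \<open>\<open>s\<^sup>k\<close> for \<open>s = \<plusminus>1\<close>, where \<open>s\<^sup>-\<^sup>k = s\<^sup>k\<close>.\<close>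

definition sgnpow :: "'a::field fps \<Rightarrow> int \<Rightarrow> 'a fps" where
  "sgnpow s k = s ^ nat \<bar>k\<bar>"

lemma sgnpow_shift:
  assumes "s * s = 1"
  shows "sgnpow s (k + 1) = s * sgnpow s k"
proof (cases "k \<ge> 0")
  case True
  then have "nat \<bar>k + 1\<bar> = Suc (nat \<bar>k\<bar>)" by simp
  then show ?thesis by (simp only: sgnpow_def power_Suc)
next
  case False
  then have "nat \<bar>k\<bar> = Suc (nat \<bar>k + 1\<bar>)" by simp
  then show ?thesis using assms by (simp only: sgnpow_def power_Suc mult.assoc[symmetric] mult_1)
qed

definition jprod :: "nat \<Rightarrow> nat \<Rightarrow> 'a::field fps \<Rightarrow> nat \<Rightarrow> 'a fps" where
  "jprod b a s N = (\<Prod>i<N. (1 + s * fps_X ^ (b * i + a)) * (1 + s * fps_X ^ (b * i + b - a)))"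

definition theta_sum :: "nat \<Rightarrow> nat \<Rightarrow> 'a::field fps \<Rightarrow> nat \<Rightarrow> 'a fps" where
  "theta_sum b a s N = (\<Sum>k\<in>{- int N..int N}. sgnpow s k * fps_X ^ jexp b a k)"

lemma sum_int_shift:
  fixes g :: "int \<Rightarrow> 'a::comm_monoid_add"
  assumes "\<And>k. \<bar>k\<bar> > int N \<Longrightarrow> g k = 0" "\<bar>c\<bar> \<le> 1"
  shows "(\<Sum>k\<in>{- int (Suc N)..int (Suc N)}. g (k + c)) = (\<Sum>k\<in>{- int N..int N}. g k)"
proof -
  have "(\<Sum>k\<in>{- int (Suc N)..int (Suc N)}. g (k + c)) = (\<Sum>k\<in>{- int (Suc N) + c..int (Suc N) + c}. g k)"
    by (rule sum.reindex_bij_witness[of _ "\<lambda>k. k - c" "\<lambda>k. k + c"]) auto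
  also have "\<dots> = (\<Sum>k\<in>{- int N..int N}. g k)"
    using assms by (intro sum.mono_neutral_right) auto
  finally show ?thesis .
qed

text \<open>Induction on \<open>N\<close>: the new factors are \<open>1 + p\<close> and
  \<open>1 + q\<close> with \<open>p * q = fps_X ^ (b * (2*N+1))\<close>, and comparing terms gives
  exactly \<open>gbinom_Suc\<close>. Taking a sign \<open>s\<close> instead of a free variable
  avoids negative powers.\<close>

lemma finite_jacobi:
  fixes s :: "'a::field fps"
  assumes ab: "0 < a" "a \<le> b" and s: "s * s = 1"
  shows "jprod b a s N = (\<Sum>k\<in>{- int N..int N}. sgnpow s k * fps_X ^ jexp b a k * gbinom b N k)"
proof (induction N)
  case 0
  show ?case by (simp add: jprod_def gbinom_def inv_fprod_def sgnpow_def jexp_def)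
next
  case (Suc N)
  define g where "g k = sgnpow s k * fps_X ^ jexp b a k * gbinom b N k" for k
  define p q where "p = s * fps_X ^ (b * N + a)" and "q = s * fps_X ^ (b * N + b - a)"
  have g0: "g k = 0" if "\<bar>k\<bar> > int N" for k
    using gbinom_eq_0[OF that, where 'a='a] by (simp add: g_def)
  have b: "b > 0" using ab by simp
  have step: "sgnpow s k * fps_X ^ jexp b a k * gbinom b (Suc N) k
     = (1 + fps_X ^ (b * (2*N+1))) * g (k + 0) + p * g (k + -1) + q * g (k + 1)"
    if "k \<in> {- int (Suc N)..int (Suc N)}" for k
  proof -
    have k: "\<bar>k\<bar> \<le> int N + 1" and k': "k \<le> 1 + int N" "- 1 - int N \<le> k" using that by auto
    have "int (jexp b a (k + -1) + (b * N + a)) = int (jexp b a k + b * nat (int N + 1 - k))"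
      using jexp_add1[OF ab, of "k + -1"] k' by (simp add: algebra_simps)
    then have e1: "jexp b a (k + -1) + (b * N + a) = jexp b a k + b * nat (int N + 1 - k)"
      by (simp only: of_nat_eq_iff)
    have "int (jexp b a (k + 1) + (b * N + b - a)) = int (jexp b a k + b * nat (int N + 1 + k))"
      using jexp_add1[OF ab, of k] k' ab by (simp add: algebra_simps of_nat_diff)
    then have e2: "jexp b a (k + 1) + (b * N + b - a) = jexp b a k + b * nat (int N + 1 + k)"
      by (simp only: of_nat_eq_iff)
    have s1: "sgnpow s k = s * sgnpow s (k + -1)" and s2: "sgnpow s k = s * sgnpow s (k + 1)"
      using sgnpow_shift[OF s, of "k - 1"] sgnpow_shift[OF s, of k] s by (simp_all flip: mult.assoc)
    have "p * g (k + -1) = (s * sgnpow s (k + -1)) * fps_X ^ (jexp b a (k + -1) + (b * N + a)) * gbinom b N (k - 1)"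
      by (simp add: p_def g_def power_add algebra_simps)
    also have "\<dots> = sgnpow s k * fps_X ^ (jexp b a k + b * nat (int N + 1 - k)) * gbinom b N (k - 1)"
      by (simp only: s1[symmetric] e1)
    finally have t1: "p * g (k + -1) = \<dots>" .
    have "q * g (k + 1) = (s * sgnpow s (k + 1)) * fps_X ^ (jexp b a (k + 1) + (b * N + b - a)) * gbinom b N (k + 1)"
      by (simp add: q_def g_def power_add algebra_simps)
    also have "\<dots> = sgnpow s k * fps_X ^ (jexp b a k + b * nat (int N + 1 + k)) * gbinom b N (k + 1)"
      by (simp only: s2[symmetric] e2)
    finally have t2: "q * g (k + 1) = \<dots>" .
    show ?thesis unfolding t1 t2 gbinom_Suc[OF b k] power_add
      by (simp add: g_def algebra_simps)
  qed
  have pq: "p * q = fps_X ^ (b * (2*N+1))"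
  proof -
    have "p * q = (s * s) * fps_X ^ (b * N + a + (b * N + b - a))"
      unfolding p_def q_def power_add by (simp only: mult_ac)
    also have "b * N + a + (b * N + b - a) = b * (2*N+1)" using ab by (simp add: algebra_simps)
    finally show ?thesis by (simp only: s mult_1)
  qed
  have "jprod b a s (Suc N) = (1 + p) * (1 + q) * (\<Sum>k\<in>{- int N..int N}. g k)"
    using Suc by (simp add: jprod_def g_def p_def q_def mult_ac)
  also have "(1 + p) * (1 + q) = (1 + fps_X ^ (b * (2*N+1))) + p + q"
    unfolding pq[symmetric] by (simp add: algebra_simps)
  also have "(1 + fps_X ^ (b * (2*N+1)) + p + q) * (\<Sum>k\<in>{- int N..int N}. g k) 
     = (1 + fps_X ^ (b * (2*N+1))) * (\<Sum>k\<in>{- int (Suc N)..int (Suc N)}. g (k + 0))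
     + p * (\<Sum>k\<in>{- int (Suc N)..int (Suc N)}. g (k + -1)) + q * (\<Sum>k\<in>{- int (Suc N)..int (Suc N)}. g (k + 1))"
    using sum_int_shift[of N g, OF g0] by (simp only: ring_distribs)
  also have "\<dots> = (\<Sum>k\<in>{- int (Suc N)..int (Suc N)}. (1 + fps_X ^ (b * (2*N+1))) * g (k + 0) + p * g (k + -1) + q * g (k + 1))"
    by (simp only: sum.distrib sum_distrib_left)
  also have "\<dots> = (\<Sum>k\<in>{- int (Suc N)..int (Suc N)}. sgnpow s k * fps_X ^ jexp b a k * gbinom b (Suc N) k)"
    by (intro sum.cong refl step[symmetric])
  finally show ?case .
qed

text \<open>All three finite products in \<open>gbinom\<close> agree with \<open>eul b\<close> up to
  order \<open>m\<close>, so \<open>gbinom\<close> approximates the inverse of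
  \<open>eul b\<close>.\<close>

lemma gbinom_dvd:
  assumes b: "b > 0" and k: "\<bar>k\<bar> \<le> int N" and m: "m \<le> Suc (N - nat \<bar>k\<bar>)"
  shows "fps_X ^ m dvd eul b * gbinom b N k - (1 :: 'a::field fps)"
proof -
  define E F1 F2 C :: "'a fps" where "E = eul b" and "F1 = fprod b (nat (int N - k))" and "F2 = fprod b (nat (int N + k))"
    and "C = gbinom b N k"
  have d: "fps_X ^ m dvd fprod b n - E" if "m \<le> Suc n" for n
    using fprod_dvd[OF b, of n, where 'a='a] that unfolding E_def
    by (meson dvd_trans le_imp_power_dvd)
  have d1: "fps_X ^ m dvd F1 - E" "fps_X ^ m dvd F2 - E" "fps_X ^ m dvd fprod b (2*N) - E"
    using m k unfolding F1_def F2_def by (auto intro!: d)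
  have unit: "F1 * inverse F1 = 1" "F2 * inverse F2 = 1" "E * inverse E = 1"
    using b by (auto simp: F1_def F2_def E_def intro!: inverse_mult_eq_1')
  have "C = fprod b (2*N) * inverse F1 * inverse F2"
    using k by (auto simp: C_def gbinom_def inv_fprod_def F1_def F2_def)
  then have "C * F1 * F2 = fprod b (2*N) * (F1 * inverse F1) * (F2 * inverse F2)"
    by (simp only: mult_ac)
  then have C: "C * F1 * F2 = fprod b (2*N)"
    by (simp only: unit mult_1_right)
  \<comment> \<open>Multiplying by the unit \<open>E * E\<close> turns the claim into one about
    differences of products, without inverses.\<close>
  have "(E * C - 1) * (E * E) = E * (fprod b (2*N) - E) - E * C * ((F1 - E) * F2 + E * (F2 - E))"
    unfolding C[symmetric] by (simp add: algebra_simps)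
  then have "fps_X ^ m dvd (E * C - 1) * (E * E)"
    using d1 by (simp add: dvd_diff dvd_add dvd_mult dvd_mult2)
  then have "fps_X ^ m dvd (E * C - 1) * (E * E) * (inverse E * inverse E)"
    by (rule dvd_mult2)
  also have "(E * C - 1) * (E * E) * (inverse E * inverse E) = (E * C - 1) * (E * inverse E) * (E * inverse E)"
    by (simp only: mult_ac)
  finally show ?thesis unfolding unit by (simp add: E_def C_def)
qed

text \<open>The error of the term at \<open>k\<close> has order at least
  \<open>jexp b a k + N - \<bar>k\<bar> + 1\<close>, hence at least \<open>N\<close> for every
  \<open>k\<close>. The limit \<open>P\<close> stays a parameter, to be identified as an eta
  quotient in each application.\<close>

theorem jacobi_triple_product:
  fixes s :: "'a::field fps"
  assumes ab: "0 < a" "a \<le> b" and s: "s * s = 1" and lim: "jprod b a s \<longlonglongrightarrow> P"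
  shows "theta_sum b a s \<longlonglongrightarrow> eul b * P"
proof -
  have b: "b > 0" using ab by simp
  have dv: "fps_X ^ N dvd theta_sum b a s N - eul b * jprod b a s N" for N
  proof -
    have "theta_sum b a s N - eul b * jprod b a s N
       = (\<Sum>k\<in>{- int N..int N}. sgnpow s k * (fps_X ^ jexp b a k * (1 - eul b * gbinom b N k)))"
      unfolding finite_jacobi[OF ab s] theta_sum_def
      by (simp add: sum_distrib_left sum_subtractf[symmetric] algebra_simps)
    also have "fps_X ^ N dvd \<dots>"
    proof (rule dvd_sum)
      fix k assume k: "k \<in> {- int N..int N}"
      define m where "m = Suc (N - nat \<bar>k\<bar>)"
      have "fps_X ^ m dvd eul b * gbinom b N k - (1 :: 'a fps)"
        using k by (intro gbinom_dvd b) (auto simp: m_def)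
      then have "fps_X ^ m dvd 1 - eul b * (gbinom b N k :: 'a fps)"
        by (simp only: dvd_diff_commute)
      then have "fps_X ^ (jexp b a k + m) dvd fps_X ^ jexp b a k * (1 - eul b * (gbinom b N k :: 'a fps))"
        unfolding power_add by (rule mult_dvd_mono[OF dvd_refl])
      moreover have "int (jexp b a k) \<ge> \<bar>k\<bar> - 1"
        using jexp_ge(1)[OF ab, of k] by (simp add: int_jexp ab)
      then have "N \<le> jexp b a k + m" using k by (auto simp: m_def)
      ultimately show "fps_X ^ N dvd sgnpow s k * (fps_X ^ jexp b a k * (1 - eul b * gbinom b N k))"
        by (meson dvd_mult dvd_trans le_imp_power_dvd)
    qed
    finally show ?thesis .
  qed
  have "(\<lambda>N. theta_sum b a s N - eul b * jprod b a s N) \<longlonglongrightarrow> 0"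
  proof (rule tendsto_fpsI)
    fix n
    show "\<forall>\<^sub>F N in sequentially. (theta_sum b a s N - eul b * jprod b a s N) $ n = 0 $ n"
      using eventually_gt_at_top[of n] 
    proof eventually_elim
      case (elim N)
      then show ?case using dv[of N, unfolded fps_X_power_dvd_iff] by simp
    qed
  qed
  from tendsto_add_fps[OF this tendsto_mult_fps[OF tendsto_const[of "eul b"] lim]]
  show ?thesis by simp
qed

section \<open>Theta series and their 3-dissections\<close>

definition fplus :: "nat \<Rightarrow> nat \<Rightarrow> 'a::field fps" where
  "fplus c n = (\<Prod>m\<in>{1..n}. 1 + fps_X ^ (c * m))"

definition fodd :: "nat \<Rightarrow> nat \<Rightarrow> 'a::field fps" where
  "fodd c n = (\<Prod>i<n. 1 - fps_X ^ (c * (2 * i + 1)))"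

text \<open>Limits of quotients are obtained from product relations between finite products, so that
  no division occurs at a finite stage.\<close>

lemma tendsto_divide_fps:
  fixes F G H :: "nat \<Rightarrow> 'a::field fps"
  assumes eq: "\<And>n. F n * G n = H n" and lim: "G \<longlonglongrightarrow> g" "H \<longlonglongrightarrow> h"
    and unit: "\<And>n. G n $ 0 \<noteq> 0" "g $ 0 \<noteq> 0"
  shows "F \<longlonglongrightarrow> h * inverse g"
proof -
  have "F n = H n * inverse (G n)" for n
    using inverse_mult_eq_1'[OF unit(1), of n] by (simp add: eq[symmetric] mult.assoc)
  then have "F = (\<lambda>n. H n * inverse (G n))" by blast
  then show ?thesis
    using tendsto_mult_fps[OF lim(2) tendsto_inverse_fps[OF lim(1) unit(2)]] by simp
qed

lemma one_minus_power_mult: "(1 + y) * (1 - y) = 1 - (y::'a::comm_ring_1)^2"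
  by (simp add: algebra_simps power2_eq_square)

lemma fplus_fprod: "fplus c n * fprod c n = fprod (2 * c) n"
proof -
  have "(1 + fps_X ^ (c * m)) * (1 - fps_X ^ (c * m)) = (1 - fps_X ^ (2 * c * m) :: 'a fps)" for m
    unfolding one_minus_power_mult power_mult[symmetric] by (simp only: mult_ac)
  then show ?thesis by (simp only: fplus_def fprod_def prod.distrib[symmetric])
qed

lemma fplus_nth_0: "c > 0 \<Longrightarrow> fplus c n $ 0 = 1"
  by (induction n) (auto simp: fplus_def)

lemma fodd_nth_0: "c > 0 \<Longrightarrow> fodd c n $ 0 = 1"
  by (induction n) (auto simp: fodd_def)

lemma fplus_tendsto: "c > 0 \<Longrightarrow> fplus c \<longlonglongrightarrow> eul (2 * c) * inverse (eul c)"
  by (rule tendsto_divide_fps[where G = "fprod c" and H = "fprod (2 * c)"])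
     (auto intro: fprod_tendsto fplus_fprod)

lemma fplus_Suc: "fplus c (Suc n) = fplus c n * (1 + fps_X ^ (c * Suc n))"
  by (simp add: fplus_def)

lemma fodd_Suc: "fodd c (Suc n) = fodd c n * (1 - fps_X ^ (c * (2 * n + 1)))"
  by (simp add: fodd_def)

lemma fodd_fprod: "fodd c n * fprod (2 * c) n = (fprod c (2 * n) :: 'a::field fps)"
proof (induction n)
  case (Suc n)
  have "fodd c (Suc n) * fprod (2 * c) (Suc n)
     = (fodd c n * fprod (2 * c) n :: 'a fps) * (1 - fps_X ^ (c * (2 * n + 1))) * (1 - fps_X ^ (2 * c * Suc n))"
    by (simp only: fodd_Suc fprod_Suc mult_ac)
  also have "\<dots> = fprod c (2 * n) * (1 - fps_X ^ (c * Suc (2 * n))) * (1 - fps_X ^ (c * Suc (Suc (2 * n))))"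
    unfolding Suc.IH by (simp add: algebra_simps)
  also have "\<dots> = fprod c (Suc (Suc (2 * n)))"
    by (simp only: fprod_Suc)
  finally show ?case by simp
qed (simp add: fodd_def)

lemma fodd_tendsto: "c > 0 \<Longrightarrow> fodd c \<longlonglongrightarrow> eul c * inverse (eul (2 * c))"
  by (rule tendsto_divide_fps[where G = "fprod (2 * c)" and H = "\<lambda>n. fprod c (2 * n)"])
     (auto intro: fprod_tendsto fprod_tendsto_subseq fodd_fprod)

lemma jprod_Suc: "jprod b a s (Suc N) = jprod b a s N * ((1 + s * fps_X ^ (b * N + a)) * (1 + s * fps_X ^ (b * N + b - a)))"
  by (simp add: jprod_def)

text \<open>For \<open>a = b\<close> the second factor at \<open>i = 0\<close> is 1 + 1, and at
  later \<open>i\<close> it repeats the first factor at \<open>i - 1\<close>.\<close>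

lemma jprod_psi: "jprod c c 1 (Suc N) = 2 * fplus c (Suc N) * fplus c N"
proof (induction N)
  case 0
  show ?case by (simp add: jprod_def fplus_def)
next
  case (Suc N)
  show ?case unfolding jprod_Suc[of _ _ _ "Suc N"] Suc.IH
    by (simp add: fplus_def algebra_simps)
qed

lemma LIMSEQ_mult_subseq: 
  assumes "(f :: nat \<Rightarrow> 'a::topological_space) \<longlonglongrightarrow> L" "c > 0"
  shows "(\<lambda>n. f (c * n)) \<longlonglongrightarrow> L"
  using LIMSEQ_subseq_LIMSEQ[OF assms(1), of "\<lambda>n. c * n"] assms(2)
  by (simp add: strict_mono_def o_def)

text \<open>The exponents are \<open>c\<close> times triangular numbers, and k and -1 - k give the
  same one; the sum is therefore twice psi(q^c).\<close>

lemma theta_psi: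
  assumes c: "c > 0"
  shows "theta_sum c c (1 :: 'a::field fps) \<longlonglongrightarrow> 2 * eul (2 * c) ^ 2 * inverse (eul c)"
proof -
  define p :: "'a fps" where "p = eul (2 * c) * inverse (eul c)"
  have "(\<lambda>N. 2 * fplus c (Suc N) * fplus c N) \<longlonglongrightarrow> 2 * p * p"
    using fplus_tendsto[OF c, where 'a='a] unfolding p_def
    by (intro tendsto_mult_fps tendsto_const) (simp_all add: LIMSEQ_Suc)
  then have "jprod c c 1 \<longlonglongrightarrow> 2 * p * p"
    unfolding jprod_psi[symmetric] by (rule LIMSEQ_imp_Suc)
  from jacobi_triple_product[OF c order_refl _ this]
  have "theta_sum c c 1 \<longlonglongrightarrow> eul c * (2 * p * p)" by simp
  also have "eul c * (2 * p * p) = (eul c * inverse (eul c)) * (2 * eul (2 * c) ^ 2 * inverse (eul c))"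
    by (simp add: p_def power2_eq_square mult_ac)
  also have "eul c * inverse (eul c) = (1 :: 'a fps)"
    using c by (intro inverse_mult_eq_1') simp
  finally show ?thesis by simp
qed

lemma jprod_phi: "jprod (2 * c) c (-1) N = fodd c N ^ 2"
proof -
  have "2 * c * i + 2 * c - c = c * (2 * i + 1)" "2 * c * i + c = c * (2 * i + 1)" for i
    by (simp_all add: algebra_simps)
  then show ?thesis
    by (simp only: jprod_def fodd_def power2_eq_square prod.distrib) simp
qed

text \<open>The exponents are c k^2 with signs (-1)^k: this is phi(-q^c).\<close>

lemma theta_phi:
  assumes c: "c > 0"
  shows "theta_sum (2 * c) c (-1 :: 'a::field fps) \<longlonglongrightarrow> eul c ^ 2 * inverse (eul (2 * c))"
proof -
  define p :: "'a fps" where "p = eul c * inverse (eul (2 * c))"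
  have "jprod (2 * c) c (-1) \<longlonglongrightarrow> p ^ 2"
    unfolding jprod_phi p_def by (intro tendsto_power_fps fodd_tendsto c)
  from jacobi_triple_product[OF c _ _ this]
  have "theta_sum (2 * c) c (-1) \<longlonglongrightarrow> eul (2 * c) * p ^ 2" by simp
  also have "eul (2 * c) * p ^ 2 = (eul (2 * c) * inverse (eul (2 * c))) * (eul c ^ 2 * inverse (eul (2 * c)))"
    by (simp add: p_def power2_eq_square mult_ac)
  also have "eul (2 * c) * inverse (eul (2 * c)) = (1 :: 'a fps)"
    using c by (intro inverse_mult_eq_1') simp
  finally show ?thesis by simp
qed

text \<open>The exponents in \<open>jprod\<close> are \<open>c\<close> times the numbers prime to 3;
  \<open>fplus (3 * c)\<close> supplies the multiples of 3.\<close>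

lemma jprod_third: "jprod (3 * c) c 1 N * fplus (3 * c) N = (fplus c (3 * N) :: 'a::field fps)"
proof (induction N)
  case (Suc N)
  have n: "3 * Suc N = Suc (Suc (Suc (3 * N)))" by simp
  have e: "3 * c * N + c = c * Suc (3 * N)" "3 * c * N + 3 * c - c = c * Suc (Suc (3 * N))"
    "3 * c * Suc N = c * Suc (Suc (Suc (3 * N)))" by (simp_all add: algebra_simps)
  have "jprod (3 * c) c 1 (Suc N) * fplus (3 * c) (Suc N) = (jprod (3 * c) c 1 N * fplus (3 * c) N :: 'a fps)
     * (1 + fps_X ^ (3 * c * N + c)) * (1 + fps_X ^ (3 * c * N + 3 * c - c)) * (1 + fps_X ^ (3 * c * Suc N))"
    by (simp only: jprod_Suc fplus_Suc mult_ac mult_1)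
  also have "\<dots> = fplus c (3 * Suc N)"
    unfolding Suc.IH e n by (simp only: fplus_Suc)
  finally show ?case .
qed (simp add: jprod_def fplus_def)

text \<open>The exponents in \<open>jprod\<close> are \<open>c\<close> times the numbers congruent
  to 1 or 5 modulo 6; \<open>fodd (3 * c)\<close> supplies the odd multiples of 3.\<close>

lemma jprod_sixth: "jprod (6 * c) c (-1) N * fodd (3 * c) N = (fodd c (3 * N) :: 'a::field fps)"
proof (induction N)
  case (Suc N)
  have n: "3 * Suc N = Suc (Suc (Suc (3 * N)))" by simp
  have e: "6 * c * N + c = c * (2 * (3 * N) + 1)" "6 * c * N + 6 * c - c = c * (2 * Suc (Suc (3 * N)) + 1)"
    "3 * c * (2 * N + 1) = c * (2 * Suc (3 * N) + 1)" by (simp_all add: algebra_simps)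
  have "jprod (6 * c) c (-1) (Suc N) * fodd (3 * c) (Suc N) = (jprod (6 * c) c (-1) N * fodd (3 * c) N :: 'a fps)
     * (1 - fps_X ^ (6 * c * N + c)) * (1 - fps_X ^ (6 * c * N + 6 * c - c)) * (1 - fps_X ^ (3 * c * (2 * N + 1)))"
    by (simp only: jprod_Suc fodd_Suc mult_minus1 mult_ac diff_conv_add_uminus)
  also have "\<dots> = fodd c (3 * Suc N)"
    unfolding Suc.IH e n by (simp only: fodd_Suc mult_ac)
  finally show ?case .
qed (simp add: jprod_def fodd_def)

lemma theta_third:
  assumes c: "c > 0"
  shows "theta_sum (3 * c) c (1 :: 'a::field fps) \<longlonglongrightarrow>
    eul (2 * c) * eul (3 * c) ^ 2 * inverse (eul c) * inverse (eul (6 * c))"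
proof -
  define p :: "'a fps" where "p = eul (2 * c) * inverse (eul c)"
  define r :: "'a fps" where "r = eul (2 * (3 * c)) * inverse (eul (3 * c))"
  have "jprod (3 * c) c 1 \<longlonglongrightarrow> p * inverse r"
    unfolding p_def r_def
    by (rule tendsto_divide_fps[OF jprod_third fplus_tendsto LIMSEQ_mult_subseq[OF fplus_tendsto]])
       (use c in \<open>simp_all add: fplus_nth_0\<close>)
  from jacobi_triple_product[OF c _ _ this]
  have "theta_sum (3 * c) c 1 \<longlonglongrightarrow> eul (3 * c) * (p * inverse r)" by simp
  also have "inverse r = inverse (eul (6 * c)) * eul (3 * c)"
    using c by (simp add: r_def fps_inverse_mult fps_inverse_idempotent)
  finally show ?thesis by (simp add: p_def power2_eq_square mult_ac)
qed

lemma theta_sixth: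
  assumes c: "c > 0"
  shows "theta_sum (6 * c) c (-1 :: 'a::field fps) \<longlonglongrightarrow>
    eul c * eul (6 * c) ^ 2 * inverse (eul (2 * c)) * inverse (eul (3 * c))"
proof -
  define p :: "'a fps" where "p = eul c * inverse (eul (2 * c))"
  define r :: "'a fps" where "r = eul (3 * c) * inverse (eul (2 * (3 * c)))"
  have "jprod (6 * c) c (-1) \<longlonglongrightarrow> p * inverse r"
    unfolding p_def r_def
    by (rule tendsto_divide_fps[OF jprod_sixth fodd_tendsto LIMSEQ_mult_subseq[OF fodd_tendsto]])
       (use c in \<open>simp_all add: fodd_nth_0\<close>)
  from jacobi_triple_product[OF c _ _ this]
  have "theta_sum (6 * c) c (-1) \<longlonglongrightarrow> eul (6 * c) * (p * inverse r)" by simp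
  also have "inverse r = inverse (eul (3 * c)) * eul (6 * c)"
    using c by (simp add: r_def fps_inverse_mult fps_inverse_idempotent)
  finally show ?thesis by (simp add: p_def power2_eq_square mult_ac)
qed

text \<open>The bound \<open>3 * N + 1\<close> lets all three residue classes run over the same
  symmetric range.\<close>

lemma sum_int_by_residues_mod_3:
  fixes g :: "int \<Rightarrow> 'a::comm_monoid_add"
  shows "(\<Sum>k\<in>{- int (3 * N + 1)..int (3 * N + 1)}. g k)
     = (\<Sum>k\<in>{- int N..int N}. g (3 * k - 1)) + (\<Sum>k\<in>{- int N..int N}. g (3 * k)) + (\<Sum>k\<in>{- int N..int N}. g (3 * k + 1))"
proof -
  let ?K = "{- int N..int N}"
  have *: "{- int (3 * N + 1)..int (3 * N + 1)} = (\<lambda>k. 3 * k - 1) ` ?K \<union> (\<lambda>k. 3 * k) ` ?K \<union> (\<lambda>k. 3 * k + 1) ` ?K"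
    (is "?L = ?R")
  proof
    show "?R \<subseteq> ?L" by auto
    show "?L \<subseteq> ?R"
    proof
      fix k assume k: "k \<in> ?L"
      consider "k mod 3 = 0" | "k mod 3 = 1" | "k mod 3 = 2" by linarith
      then show "k \<in> ?R"
      proof cases
        case 1
        then have "k = 3 * (k div 3)" "k div 3 \<in> ?K" using k by auto
        then show ?thesis by blast
      next
        case 2
        then have "k = 3 * (k div 3) + 1" using div_mult_mod_eq[of k 3] by (simp add: algebra_simps)
        moreover from this have "k div 3 \<in> ?K" using k by auto
        ultimately have "k = 3 * (k div 3) + 1" "k div 3 \<in> ?K" by blast+
        then show ?thesis by blast
      next
        case 3
        then have "k = 3 * (k div 3 + 1) - 1" using div_mult_mod_eq[of k 3] by (simp add: algebra_simps)
        moreover from this have "k div 3 + 1 \<in> ?K" using k by auto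
        ultimately have "k = 3 * (k div 3 + 1) - 1" "k div 3 + 1 \<in> ?K" by blast+
        then show ?thesis by blast
      qed
    qed
  qed
  have "(\<lambda>k. 3 * k - 1) ` ?K \<inter> (\<lambda>k. 3 * k) ` ?K = {}"
    "((\<lambda>k. 3 * k - 1) ` ?K \<union> (\<lambda>k. 3 * k) ` ?K) \<inter> (\<lambda>k. 3 * k + 1) ` ?K = {}"
    by (auto; presburger)+
  then show ?thesis unfolding *
    by (simp add: sum.union_disjoint sum.reindex inj_on_def)
qed

lemma sum_int_reflect:
  fixes g :: "int \<Rightarrow> 'a::comm_monoid_add"
  shows "(\<Sum>k\<in>{- int N..int N}. g (- k)) = (\<Sum>k\<in>{- int N..int N}. g k)"
  by (rule sum.reindex_bij_witness[of _ uminus uminus]) auto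

text \<open>Doubling removes the division by 2 and the truncation, leaving a polynomial identity in
  the indices.\<close>

lemma jexp_eqI:
  assumes "0 < a" "a \<le> b" "0 < a'" "a' \<le> b'"
    and "2 * int a * k + int b * (k * (k - 1)) = 2 * int a' * k' + int b' * (k' * (k' - 1)) + 2 * int c"
  shows "jexp b a k = jexp b' a' k' + c"
proof -
  have *: "2 * int (jexp b a k) = 2 * int a * k + int b * (k * (k - 1))" if "0 < a" "a \<le> b" for a b k
    using that by (simp add: int_jexp algebra_simps)
  have "2 * int (jexp b a k) = 2 * int (jexp b' a' k' + c)"
    using assms by (simp add: *)
  then show ?thesis by (simp only: mult_cancel_left of_nat_eq_iff) simp
qed

lemma sgnpow_one [simp]: "sgnpow 1 k = 1"
  by (simp add: sgnpow_def)

lemma sgnpow_minus_one: "sgnpow (-1) k = (if even k then 1 else -1)"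
  by (simp add: sgnpow_def even_nat_iff)

text \<open>The classes of -1 and 0 modulo 3 give the same series after the reflection of
  \<open>k\<close>; the class of 1 gives the theta series of psi in q^9.\<close>

lemma theta_sum_psi_dissect:
  "theta_sum 1 1 1 (3 * N + 1) = 2 * theta_sum 9 3 1 N + fps_X * theta_sum 9 9 (1 :: 'a::field fps) N"
proof -
  have e: "jexp 1 1 (3 * k - 1) = jexp 9 3 k + 0" "jexp 1 1 (3 * k) = jexp 9 3 (- k) + 0"
    "jexp 1 1 (3 * k + 1) = jexp 9 9 k + 1" for k
    by (rule jexp_eqI; simp add: algebra_simps)+
  have r: "(\<Sum>k\<in>{- int N..int N}. fps_X ^ jexp 9 3 (- k) :: 'a fps) = (\<Sum>k\<in>{- int N..int N}. fps_X ^ jexp 9 3 k)"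
    by (rule sum_int_reflect)
  show ?thesis
    unfolding theta_sum_def sum_int_by_residues_mod_3
    by (simp only: e r sgnpow_one mult_1 add_0_right power_add sum_distrib_left) (simp add: mult_ac sum_distrib_left)
qed

lemma theta_sum_phi_dissect:
  "theta_sum 2 1 (-1) (3 * N + 1) = theta_sum 18 9 (-1) N - 2 * fps_X * theta_sum 18 3 (-1 :: 'a::field fps) N"
proof -
  have e: "jexp 2 1 (3 * k - 1) = jexp 18 3 k + 1" "jexp 2 1 (3 * k) = jexp 18 9 k + 0"
    "jexp 2 1 (3 * k + 1) = jexp 18 3 (- k) + 1" for k
    by (rule jexp_eqI; simp add: algebra_simps)+
  have s: "sgnpow (-1) (3 * k - 1) = - sgnpow (-1 :: 'a fps) k" "sgnpow (-1) (3 * k) = sgnpow (-1 :: 'a fps) k"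
    "sgnpow (-1) (3 * k + 1) = - sgnpow (-1 :: 'a fps) (- k)" for k
    by (auto simp: sgnpow_minus_one)
  have r: "(\<Sum>k\<in>{- int N..int N}. - sgnpow (-1) (- k) * (fps_X ^ jexp 18 3 (- k) * fps_X ^ 1) :: 'a fps)
     = (\<Sum>k\<in>{- int N..int N}. - sgnpow (-1) k * (fps_X ^ jexp 18 3 k * fps_X ^ 1))"
    by (rule sum_int_reflect)
  show ?thesis
    unfolding theta_sum_def sum_int_by_residues_mod_3
    by (simp only: e s power_add r) (simp add: sum_negf sum_distrib_left mult_ac)
qed

lemma LIMSEQ_3_mult_plus_1:
  assumes "(f :: nat \<Rightarrow> 'a::topological_space) \<longlonglongrightarrow> L"
  shows "(\<lambda>n. f (3 * n + 1)) \<longlonglongrightarrow> L"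
  using LIMSEQ_subseq_LIMSEQ[OF assms, of "\<lambda>n. 3 * n + 1"]
  by (simp add: strict_mono_def o_def)

lemma eul_inverse: "k > 0 \<Longrightarrow> inverse (eul k) * eul k = 1"
  by (intro inverse_mult_eq_1) simp

lemma eul_inverse_assoc: "k > 0 \<Longrightarrow> inverse (eul k) * (eul k * f) = f" "k > 0 \<Longrightarrow> eul k * (inverse (eul k) * f) = f"
  by (simp_all add: eul_inverse mult.commute[of "eul k" "inverse (eul k)"] flip: mult.assoc)

text \<open>Two expressions for the limit of one theta sum, cleared of denominators. Apart from
  \<open>eul 1\<close>, \<open>eul 2\<close> and the explicit \<open>fps_X\<close>, only series in
  q^3 occur, as \<open>norm3_linear\<close> requires.\<close>

lemma psi_dissection:
  "eul 2 ^ 2 * (eul 3 * eul 9 * eul 18) = eul 1 * (eul 6 * eul 9 ^ 3 + fps_X * (eul 3 * eul 18 ^ 3) :: 'a::field_char_0 fps)"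
proof -
  have "(\<lambda>N. theta_sum 1 1 1 (3 * N + 1)) \<longlonglongrightarrow> 2 * eul (2 * 1) ^ 2 * inverse (eul 1 :: 'a fps)"
    by (intro LIMSEQ_3_mult_plus_1 theta_psi) simp
  moreover have "(\<lambda>N. theta_sum 1 1 1 (3 * N + 1)) \<longlonglongrightarrow>
     2 * (eul (2 * 3) * eul (3 * 3) ^ 2 * inverse (eul 3) * inverse (eul (6 * 3)))
     + fps_X * (2 * eul (2 * 9) ^ 2 * inverse (eul 9 :: 'a fps))"
    unfolding theta_sum_psi_dissect
    using theta_third[of 3, where 'a='a] theta_psi[of 9, where 'a='a]
    by (intro tendsto_add_fps tendsto_mult_fps tendsto_const) simp_all
  ultimately have "2 * eul (2 * 1) ^ 2 * inverse (eul 1 :: 'a fps) = 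
     2 * (eul (2 * 3) * eul (3 * 3) ^ 2 * inverse (eul 3) * inverse (eul (6 * 3)))
     + fps_X * (2 * eul (2 * 9) ^ 2 * inverse (eul 9 :: 'a fps))"
    by (rule LIMSEQ_unique)
  then have "2 * (eul 2 ^ 2 * inverse (eul 1 :: 'a fps)) = 
     2 * (eul 6 * eul 9 ^ 2 * inverse (eul 3) * inverse (eul 18)
     + fps_X * (eul 18 ^ 2 * inverse (eul 9)))"
    by (simp only: mult_1_right distrib_left mult_ac) (simp add: mult_ac)
  then have "eul 2 ^ 2 * inverse (eul 1 :: 'a fps) = 
     eul 6 * eul 9 ^ 2 * inverse (eul 3) * inverse (eul 18) + fps_X * (eul 18 ^ 2 * inverse (eul 9))"
    by (simp only: mult_cancel_left) simp
  then have "(eul 2 ^ 2 * inverse (eul 1)) * (eul 1 * eul 3 * eul 9 * eul 18) = 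
     (eul 6 * eul 9 ^ 2 * inverse (eul 3) * inverse (eul 18) + fps_X * (eul 18 ^ 2 * inverse (eul 9 :: 'a fps)))
     * (eul 1 * eul 3 * eul 9 * eul 18)"
    by simp
  then have "eul 2 ^ 2 * (eul 3 * eul 9 * eul 18) * (inverse (eul 1) * eul 1) = 
     eul 6 * eul 9 ^ 3 * eul 1 * (inverse (eul 3) * eul 3) * (inverse (eul 18) * eul 18)
     + fps_X * (eul 18 ^ 3 * eul 3 * eul 1) * (inverse (eul 9) * eul 9 :: 'a fps)"
    by (simp add: algebra_simps power2_eq_square power3_eq_cube)
  then show ?thesis by (simp add: eul_inverse eul_inverse_assoc algebra_simps del: One_nat_def)
qed

lemma phi_dissection:
  "eul 1 ^ 2 * (eul 6 * eul 9 * eul 18) = eul 2 * (eul 6 * eul 9 ^ 3 - 2 * fps_X * (eul 3 * eul 18 ^ 3) :: 'a::field_char_0 fps)"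
proof -
  have "(\<lambda>N. theta_sum 2 1 (-1) (3 * N + 1)) \<longlonglongrightarrow> eul 1 ^ 2 * inverse (eul 2 :: 'a fps)"
    using theta_phi[of 1, where 'a='a] by (intro LIMSEQ_3_mult_plus_1) simp
  moreover have "(\<lambda>N. theta_sum 2 1 (-1) (3 * N + 1)) \<longlonglongrightarrow>
     eul 9 ^ 2 * inverse (eul (2 * 9))
     + (- 2 * fps_X) * (eul 3 * eul (6 * 3) ^ 2 * inverse (eul (2 * 3)) * inverse (eul (3 * 3) :: 'a fps))"
    unfolding theta_sum_phi_dissect diff_conv_add_uminus minus_mult_left
    using theta_sixth[of 3, where 'a='a] theta_phi[of 9, where 'a='a]
    by (intro tendsto_add_fps tendsto_mult_fps tendsto_const) simp_all
  ultimately have "eul 1 ^ 2 * inverse (eul 2 :: 'a fps) = 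
     eul 9 ^ 2 * inverse (eul (2 * 9))
     + (- 2 * fps_X) * (eul 3 * eul (6 * 3) ^ 2 * inverse (eul (2 * 3)) * inverse (eul (3 * 3) :: 'a fps))"
    by (rule LIMSEQ_unique)
  then have "(eul 1 ^ 2 * inverse (eul 2)) * (eul 2 * eul 6 * eul 9 * eul 18) = 
     (eul 9 ^ 2 * inverse (eul 18) + (- 2 * fps_X) * (eul 3 * eul 18 ^ 2 * inverse (eul 6) * inverse (eul 9 :: 'a fps)))
     * (eul 2 * eul 6 * eul 9 * eul 18)"
    by simp
  then have "eul 1 ^ 2 * (eul 6 * eul 9 * eul 18) * (inverse (eul 2) * eul 2) = 
     eul 6 * eul 9 ^ 3 * eul 2 * (inverse (eul 18) * eul 18)
     - 2 * fps_X * (eul 18 ^ 3 * eul 3 * eul 2) * (inverse (eul 6) * eul 6) * (inverse (eul 9) * eul 9 :: 'a fps)"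
    by (simp add: algebra_simps power2_eq_square power3_eq_cube)
  then show ?thesis by (simp add: eul_inverse eul_inverse_assoc algebra_simps del: One_nat_def)
qed

section \<open>Eta quotient identities of level 6\<close>

lemma tendsto_compose_fps:
  fixes f :: "'b \<Rightarrow> 'a::field fps"
  assumes "(f \<longlongrightarrow> a) F"
  shows "((\<lambda>x. f x oo g) \<longlongrightarrow> a oo g) F"
proof (rule tendsto_fpsI)
  fix n
  have "\<forall>\<^sub>F x in F. \<forall>i\<in>{0..n}. f x $ i = a $ i"
    using assms by (auto simp: tendsto_fps_iff intro!: eventually_ball_finite)
  then show "\<forall>\<^sub>F x in F. (f x oo g) $ n = (a oo g) $ n"
    by eventually_elim (simp add: fps_compose_nth)
qed

lemma fprod_dilate: "c > 0 \<Longrightarrow> fprod k n oo fps_X ^ c = (fprod (c * k) n :: 'a::field fps)"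
  by (simp add: fprod_def fps_compose_prod_distrib fps_compose_sub_distrib fps_X_power_compose mult_ac flip: power_mult)

lemma eul_dilate:
  assumes "k > 0" "c > 0"
  shows "eul k oo fps_X ^ c = (eul (c * k) :: 'a::field fps)"
proof -
  have "(\<lambda>n. fprod k n oo fps_X ^ c) \<longlonglongrightarrow> (eul k oo fps_X ^ c :: 'a fps)"
    by (intro tendsto_compose_fps fprod_tendsto assms)
  moreover have "(\<lambda>n. fprod k n oo fps_X ^ c) \<longlonglongrightarrow> (eul (c * k) :: 'a fps)"
    unfolding fprod_dilate[OF assms(2)] using assms by (intro fprod_tendsto) simp
  ultimately show ?thesis by (rule LIMSEQ_unique)
qed

definition twist :: "'a::field \<Rightarrow> 'a fps \<Rightarrow> 'a fps" where
  "twist c f = f oo (fps_const c * fps_X)"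

lemma twist_mult: "twist c (f * g) = twist c f * twist c g"
  and twist_add: "twist c (f + g) = twist c f + twist c g"
  and twist_diff: "twist c (f - g) = twist c f - twist c g"
  and twist_minus: "twist c (- f) = - twist c f"
  and twist_power: "twist c (f ^ n) = twist c f ^ n"
  and twist_1 [simp]: "twist c 1 = 1"
  and twist_X: "twist c fps_X = fps_const c * fps_X"
  by (simp_all add: twist_def fps_compose_mult_distrib fps_compose_add_distrib fps_compose_sub_distrib
      fps_compose_power fps_compose_uminus fps_X_fps_compose_startby0)

lemma twist_numeral [simp]: "twist c (numeral n) = numeral n"
  by (simp add: twist_def numeral_fps_const)

lemma twist_nth: "twist c f $ n = c ^ n * f $ n"
  by (simp add: twist_def)

lemma twist_tendsto: "(f \<longlongrightarrow> a) F \<Longrightarrow> ((\<lambda>x. twist c (f x)) \<longlongrightarrow> twist c a) F"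
  unfolding twist_def by (rule tendsto_compose_fps)

lemma twist_X_power: "twist c (fps_X ^ n) = fps_const (c ^ n) * fps_X ^ n"
  by (simp add: twist_power twist_X power_mult_distrib)

lemma twist_eul:
  assumes "k > 0" "c ^ k = 1"
  shows "twist c (eul k) = eul k"
proof -
  have "c ^ (k * m) = 1" for m
    by (simp only: power_mult assms(2) power_one)
  then have *: "twist c (fprod k n) = fprod k n" for n
    by (induction n) (simp_all only: fprod_Suc fprod_0 twist_mult twist_diff twist_X_power twist_1 fps_const_1_eq_1 mult_1)
  have "(\<lambda>n. twist c (fprod k n)) \<longlonglongrightarrow> twist c (eul k)"
    by (intro twist_tendsto fprod_tendsto assms)
  then show ?thesis
    unfolding * using fprod_tendsto[OF assms(1)] by (rule LIMSEQ_unique)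
qed

text \<open>Finite form of E(-q) = E_2^3/(E_1 E_4), advancing two factors at a time: as
  \<open>k\<close> is odd, the factor in \<open>y\<close> pairs with its conjugate to
  \<open>1 - y ^ 2\<close>, while the factor in \<open>z\<close> is fixed and gets squared.\<close>

lemma fprod_twist_minus_one:
  assumes "odd k"
  shows "fprod k (2 * n) * twist (-1) (fprod k (2 * n)) * fprod (4 * k) n = fprod (2 * k) (2 * n) * (fprod (2 * k) n ^ 2 :: 'a::field fps)"
proof (induction n)
  case (Suc n)
  define y z :: "'a fps" where "y = fps_X ^ (k * Suc (2 * n))" and "z = fps_X ^ (k * Suc (Suc (2 * n)))"
  have t: "twist (-1) (1 - y) = 1 + y" "twist (-1) (1 - z) = 1 - z"
    using assms by (simp_all add: y_def z_def twist_diff twist_X_power)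
  have e: "2 * Suc n = Suc (Suc (2 * n))" by simp
  have f1: "fprod k (2 * Suc n) = fprod k (2 * n) * (1 - y) * (1 - z)"
    unfolding e by (simp only: fprod_Suc y_def z_def)
  have y2: "fps_X ^ (2 * k * Suc (2 * n)) = y ^ 2" "fps_X ^ (2 * k * Suc (Suc (2 * n))) = z ^ 2"
    "fps_X ^ (2 * k * Suc n) = z" "fps_X ^ (4 * k * Suc n) = z ^ 2"
    by (simp_all add: y_def z_def algebra_simps flip: power_mult)
  have f2: "fprod (2 * k) (2 * Suc n) = fprod (2 * k) (2 * n) * (1 - y ^ 2) * (1 - z ^ 2)"
    unfolding e by (simp only: fprod_Suc y2)
  have f3: "fprod (2 * k) (Suc n) = fprod (2 * k) n * (1 - z)" "fprod (4 * k) (Suc n) = fprod (4 * k) n * (1 - z ^ 2)"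
    by (simp_all only: fprod_Suc y2)
  have "fprod k (2 * Suc n) * twist (-1) (fprod k (2 * Suc n)) * fprod (4 * k) (Suc n)
    = (fprod k (2 * n) * twist (-1) (fprod k (2 * n)) * fprod (4 * k) n) * ((1 + y) * (1 - y)) * (1 - z) ^ 2 * (1 - z ^ 2)"
    unfolding f1 f3 by (simp only: twist_mult t power2_eq_square mult_ac)
  also have "\<dots> = fprod (2 * k) (2 * Suc n) * (fprod (2 * k) (Suc n) ^ 2)"
    unfolding Suc.IH f2 f3 one_minus_power_mult by (simp only: power_mult_distrib mult_ac)
  finally show ?case .
qed simp

lemma eul_twist_minus_one:
  assumes "odd k"
  shows "eul k * twist (-1) (eul k) * eul (4 * k) = (eul (2 * k) ^ 3 :: 'a::field fps)"
proof -
  have k: "k > 0" using assms by (cases k) auto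
  have "(\<lambda>n. fprod k (2 * n) * twist (-1) (fprod k (2 * n)) * fprod (4 * k) n) \<longlonglongrightarrow> eul k * twist (-1) (eul k) * (eul (4 * k) :: 'a fps)"
    using k by (intro tendsto_mult_fps twist_tendsto fprod_tendsto fprod_tendsto_subseq) simp_all
  moreover have "(\<lambda>n. fprod k (2 * n) * twist (-1) (fprod k (2 * n)) * fprod (4 * k) n) \<longlonglongrightarrow> eul (2 * k) * (eul (2 * k) ^ 2 :: 'a fps)"
    unfolding fprod_twist_minus_one[OF assms]
    using k by (intro tendsto_mult_fps tendsto_power_fps fprod_tendsto fprod_tendsto_subseq) simp_all
  ultimately have "eul k * twist (-1) (eul k) * (eul (4 * k) :: 'a fps) = eul (2 * k) * (eul (2 * k) ^ 2)"
    by (rule LIMSEQ_unique)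
  then show ?thesis by (simp add: power2_eq_square power3_eq_cube)
qed

section \<open>The norm to series in q^3 over the cube roots of unity\<close>

definition norm3 :: "'a::field \<Rightarrow> 'a fps \<Rightarrow> 'a fps" where
  "norm3 w f = f * twist w f * twist (w ^ 2) f"

lemma norm3_mult: "norm3 w (f * g) = norm3 w f * norm3 w g"
  by (simp add: norm3_def twist_mult mult_ac)

lemma norm3_power: "norm3 w (f ^ n) = norm3 w f ^ n"
  by (simp add: norm3_def twist_power power_mult_distrib)

lemma norm3_1 [simp]: "norm3 w 1 = 1"
  by (simp add: norm3_def)

lemma norm3_eul:
  assumes "k > 0" "w ^ k = 1"
  shows "norm3 w (eul k) = eul k ^ 3"
proof -
  have "(w ^ 2) ^ k = 1" using assms(2) by (metis power_commutes power_mult power_one mult.commute)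
  then show ?thesis using assms by (simp add: norm3_def twist_eul power3_eq_cube)
qed

lemma norm3_linear:
  fixes A B :: "'a::field fps"
  assumes w: "w ^ 2 = - 1 - w" and A: "twist w A = A" "twist (w ^ 2) A = A" and B: "twist w B = B" "twist (w ^ 2) B = B"
  shows "norm3 w (A + fps_X * B) = A ^ 3 + fps_X ^ 3 * B ^ 3"
proof -
  define W where "W = fps_const w"
  have W: "fps_const (w ^ 2) = - 1 - W" "W * W = - 1 - W"
    unfolding W_def using w
    by (metis fps_const_1_eq_1 fps_const_neg fps_const_sub, metis fps_const_1_eq_1 fps_const_neg fps_const_sub fps_const_mult power2_eq_square)
  \<comment> \<open>As a rewrite rule this reduces higher powers of \<open>W\<close> inside expanded
    products.\<close>
  have W3: "W * (W * f) = - f - W * f" for f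
    using W(2) by (simp add: mult.assoc[symmetric] left_diff_distrib)
  show ?thesis
    unfolding norm3_def twist_add twist_mult twist_X A B W(1) W_def[symmetric]
    by (simp add: algebra_simps power3_eq_cube W3 W(2))
qed

text \<open>For \<open>m\<close> prime to 3 the power \<open>w ^ m\<close> is again a root of the
  quadratic equation of \<open>w\<close>, so the three conjugates multiply to 1 - y^3; otherwise
  they coincide.\<close>

lemma norm3_factor:
  fixes w :: "'a::field"
  assumes w: "w ^ 2 = - 1 - w"
  shows "\<not> 3 dvd m \<Longrightarrow> norm3 w (1 - fps_X ^ m) = 1 - fps_X ^ (3 * m)"
    and "3 dvd m \<Longrightarrow> norm3 w (1 - fps_X ^ m) = (1 - fps_X ^ m) ^ 3"
proof -
  have w3: "w ^ 3 = 1"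
  proof -
    have "w ^ 3 = w * w ^ 2" by (simp add: power3_eq_cube power2_eq_square)
    also have "\<dots> = 1" unfolding w using w by (simp add: right_diff_distrib power2_eq_square)
    finally show ?thesis .
  qed
  have wm: "w ^ m = w ^ (m mod 3)" for m
  proof -
    have "w ^ m = w ^ (3 * (m div 3) + m mod 3)" by simp
    then show ?thesis by (simp only: power_add power_mult w3 power_one mult_1)
  qed
  define y :: "'a fps" where "y = fps_X ^ m"
  have n: "norm3 w (1 - y) = (1 - y) * (1 - fps_const (w ^ m) * y) * (1 - fps_const ((w ^ 2) ^ m) * y)"
    by (simp add: y_def norm3_def twist_diff twist_X_power)
  have m2: "(w ^ 2) ^ m = (w ^ m) ^ 2" by (simp only: power_mult[symmetric] mult.commute)
  {
    assume "3 dvd m"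
    then have "w ^ m = 1" by (simp add: wm[of m])
    then show "norm3 w (1 - fps_X ^ m) = (1 - fps_X ^ m) ^ 3"
      unfolding y_def[symmetric] n m2 by (simp add: power3_eq_cube)
  }
  {
    assume "\<not> 3 dvd m"
    then have "m mod 3 = 1 \<or> m mod 3 = 2" by presburger
    then have v: "(w ^ m) ^ 2 = - 1 - w ^ m"
    proof
      assume "m mod 3 = 2"
      then have "w ^ m = - 1 - w" using w by (simp add: wm[of m])
      moreover have "(- 1 - w) ^ 2 = - 1 - (- 1 - w)" using w by (simp add: power2_eq_square algebra_simps)
      ultimately show ?thesis by simp
    qed (use w in \<open>simp add: wm[of m]\<close>)
    define W where "W = fps_const (w ^ m)"
    have W: "fps_const ((w ^ m) ^ 2) = - 1 - W" "W * W = - 1 - W"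
      unfolding W_def using v
      by (metis fps_const_1_eq_1 fps_const_neg fps_const_sub, metis fps_const_1_eq_1 fps_const_neg fps_const_sub fps_const_mult power2_eq_square)
    have W3: "W * (W * f) = - f - W * f" for f
      using W(2) by (simp add: mult.assoc[symmetric] left_diff_distrib)
    have "norm3 w (1 - y) = 1 - y ^ 3"
      unfolding n m2 W(1) W_def[symmetric]
      by (simp add: algebra_simps power3_eq_cube W3 W(2))
    then show "norm3 w (1 - fps_X ^ m) = 1 - fps_X ^ (3 * m)"
      by (simp add: y_def power_mult[symmetric] mult.commute)
  }
qed

text \<open>Finite form of the statement that the norm of E_k is E_{3k}^4/E_{9k}. Factors are added
  in threes, the last of which has an exponent divisible by 3.\<close>

lemma fprod_norm3:
  fixes w :: "'a::field"
  assumes w: "w ^ 2 = - 1 - w" and k: "\<not> 3 dvd k"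
  shows "norm3 w (fprod k (3 * n)) * fprod (9 * k) n = fprod (3 * k) (3 * n) * fprod (3 * k) n ^ 3"
proof (induction n)
  case (Suc n)
  let ?a = "k * Suc (3 * n)" and ?b = "k * Suc (Suc (3 * n))" and ?c = "k * Suc (Suc (Suc (3 * n)))"
  have "coprime 3 k" using k by (simp add: prime_imp_coprime)
  moreover have "\<not> 3 dvd Suc (3 * n)" "\<not> 3 dvd Suc (Suc (3 * n))" by presburger+
  ultimately have d: "\<not> 3 dvd ?a" "\<not> 3 dvd ?b" "3 dvd ?c"
    by (simp_all add: coprime_dvd_mult_right_iff del: mult_Suc_right) presburger
  have e: "3 * Suc n = Suc (Suc (Suc (3 * n)))" by simp
  have x: "3 * k * Suc n = ?c" "9 * k * Suc n = 3 * ?c" "3 * k * Suc (3 * n) = 3 * ?a"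
    "3 * k * Suc (Suc (3 * n)) = 3 * ?b" "3 * k * Suc (Suc (Suc (3 * n))) = 3 * ?c" by simp_all
  have "norm3 w (fprod k (3 * Suc n)) * fprod (9 * k) (Suc n)
    = (norm3 w (fprod k (3 * n)) * fprod (9 * k) n) * (1 - fps_X ^ (3 * ?a)) * (1 - fps_X ^ (3 * ?b))
      * (1 - fps_X ^ ?c) ^ 3 * (1 - fps_X ^ (3 * ?c))"
    unfolding e fprod_Suc norm3_mult norm3_factor(1)[OF w d(1)] norm3_factor(1)[OF w d(2)] norm3_factor(2)[OF w d(3)] x
    by (simp only: mult_ac)
  also have "\<dots> = fprod (3 * k) (3 * Suc n) * fprod (3 * k) (Suc n) ^ 3"
    unfolding Suc.IH e fprod_Suc x power_mult_distrib by (simp only: mult_ac)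
  finally show ?case .
qed simp

lemma norm3_eul_coprime:
  fixes w :: "'a::field"
  assumes w: "w ^ 2 = - 1 - w" and k: "\<not> 3 dvd k"
  shows "norm3 w (eul k) * eul (9 * k) = eul (3 * k) ^ 4"
proof -
  have k0: "k > 0" using k by (cases k) auto
  have "(\<lambda>n. norm3 w (fprod k (3 * n)) * fprod (9 * k) n) \<longlonglongrightarrow> norm3 w (eul k) * (eul (9 * k) :: 'a fps)"
    unfolding norm3_def using k0
    by (intro tendsto_mult_fps twist_tendsto fprod_tendsto fprod_tendsto_subseq) simp_all
  moreover have "(\<lambda>n. norm3 w (fprod k (3 * n)) * fprod (9 * k) n) \<longlonglongrightarrow> eul (3 * k) * (eul (3 * k) ^ 3 :: 'a fps)"
    unfolding fprod_norm3[OF assms]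
    using k0 by (intro tendsto_mult_fps tendsto_power_fps fprod_tendsto fprod_tendsto_subseq) simp_all
  ultimately have "norm3 w (eul k) * (eul (9 * k) :: 'a fps) = eul (3 * k) * (eul (3 * k) ^ 3)"
    by (rule LIMSEQ_unique)
  then show ?thesis by (simp add: power3_eq_cube power4_eq_xxxx)
qed

text \<open>The norms of the two dissections. The norm cubes both summands of the linear factor,
  which turns the coefficient -2 into -8, and the norms of \<open>eul 1\<close> and
  \<open>eul 2\<close> are eta quotients in q^3.\<close>

lemma level6_cubed:
  fixes w :: "'a::field_char_0"
  assumes w: "w ^ 2 = - 1 - w" "w ^ 3 = 1"
  shows "eul 6 ^ 8 * eul 9 ^ 4 * eul 18 = eul 3 * (eul 6 ^ 3 * eul 9 ^ 9 + fps_X ^ 3 * (eul 3 ^ 3 * (eul 18 ^ 9 :: 'a fps)))"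
    and "eul 3 ^ 8 * eul 9 * eul 18 ^ 4 = eul 6 * (eul 6 ^ 3 * eul 9 ^ 9 - 8 * fps_X ^ 3 * (eul 3 ^ 3 * (eul 18 ^ 9 :: 'a fps)))"
proof -
  have fix3: "w ^ (3 * k) = 1" "(w ^ 2) ^ (3 * k) = 1" for k
  proof -
    have "(w ^ 2) ^ (3 * k) = ((w ^ 3) ^ k) ^ 2" by (simp only: power_mult[symmetric] mult_ac)
    then show "w ^ (3 * k) = 1" "(w ^ 2) ^ (3 * k) = 1" by (simp_all add: w(2) power_mult)
  qed
  have tw: "twist w (eul (3 * k)) = eul (3 * k)" "twist (w ^ 2) (eul (3 * k)) = eul (3 * k)" "norm3 w (eul (3 * k)) = eul (3 * k) ^ 3"
    if "k > 0" for k
    using that fix3 by (auto intro!: twist_eul norm3_eul)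
  define e1 e2 e3 e6 e9 e18 :: "'a fps" where e: "e1 = eul 1" "e2 = eul 2" "e3 = eul 3" "e6 = eul 6" "e9 = eul 9" "e18 = eul 18"
  note tw' = tw[of 1] tw[of 2] tw[of 3] tw[of 6]
  have t: "twist w e3 = e3" "twist w e6 = e6" "twist w e9 = e9" "twist w e18 = e18"
    "twist (w ^ 2) e3 = e3" "twist (w ^ 2) e6 = e6" "twist (w ^ 2) e9 = e9" "twist (w ^ 2) e18 = e18"
    "norm3 w e3 = e3 ^ 3" "norm3 w e6 = e6 ^ 3" "norm3 w e9 = e9 ^ 3" "norm3 w e18 = e18 ^ 3"
    using tw' by (simp_all add: e)
  have nz: "e3 \<noteq> 0" "e6 \<noteq> 0" "e9 \<noteq> 0" "e18 \<noteq> 0" by (simp_all add: e)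
  have n1: "norm3 w e1 * e9 = e3 ^ 4" and n2: "norm3 w e2 * e18 = e6 ^ 4"
    using norm3_eul_coprime[OF w(1), of 1] norm3_eul_coprime[OF w(1), of 2] by (simp_all add: e)
  have "norm3 w (e2 ^ 2 * (e3 * e9 * e18)) = norm3 w (e1 * (e6 * e9 ^ 3 + fps_X * (e3 * e18 ^ 3)))"
    using psi_dissection[where 'a='a] by (simp add: e)
  then have p: "norm3 w e2 ^ 2 * (e3 * e9 * e18) ^ 3 = norm3 w e1 * ((e6 * e9 ^ 3) ^ 3 + fps_X ^ 3 * (e3 * e18 ^ 3) ^ 3)"
    by (simp add: norm3_mult norm3_power t norm3_linear[OF w(1)] twist_mult twist_power power_mult_distrib)
  \<comment> \<open>The leading factor is what both sides have in common once the norms are replaced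
    and denominators cleared; it is cancelled at the end.\<close>
  have "(e3 ^ 3 * e18 ^ 2) * (e6 ^ 8 * e9 ^ 4 * e18) = (norm3 w e2 * e18) ^ 2 * (e3 * e9 * e18) ^ 3 * e9"
    unfolding n2 by (simp add: power_mult_distrib mult_ac power_numeral_reduce)
  also have "\<dots> = (norm3 w e2 ^ 2 * (e3 * e9 * e18) ^ 3) * (e18 ^ 2 * e9)"
    by (simp add: power_mult_distrib mult_ac)
  also have "\<dots> = (norm3 w e1 * e9) * e18 ^ 2 * ((e6 * e9 ^ 3) ^ 3 + fps_X ^ 3 * (e3 * e18 ^ 3) ^ 3)"
    unfolding p by (simp only: mult_ac)
  also have "\<dots> = (e3 ^ 3 * e18 ^ 2) * (e3 * (e6 ^ 3 * e9 ^ 9 + fps_X ^ 3 * (e3 ^ 3 * e18 ^ 9)))"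
    unfolding n1 by (simp add: power_mult_distrib mult_ac power_numeral_reduce)
  finally show "eul 6 ^ 8 * eul 9 ^ 4 * eul 18 = eul 3 * (eul 6 ^ 3 * eul 9 ^ 9 + fps_X ^ 3 * (eul 3 ^ 3 * (eul 18 ^ 9 :: 'a fps)))"
    using nz by (simp add: e[symmetric])
  have "norm3 w (e1 ^ 2 * (e6 * e9 * e18)) = norm3 w (e2 * (e6 * e9 ^ 3 + fps_X * (- 2 * (e3 * e18 ^ 3))))"
    using phi_dissection[where 'a='a] by (simp add: e mult_ac)
  then have p: "norm3 w e1 ^ 2 * (e6 * e9 * e18) ^ 3 = norm3 w e2 * ((e6 * e9 ^ 3) ^ 3 + fps_X ^ 3 * (- 2 * (e3 * e18 ^ 3)) ^ 3)"
    by (simp add: norm3_mult norm3_power t norm3_linear[OF w(1)] twist_mult twist_power twist_minus power_mult_distrib del: mult_minus_left mult_minus_right)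
  have "(e6 ^ 3 * e9 ^ 2) * (e3 ^ 8 * e9 * e18 ^ 4) = (norm3 w e1 * e9) ^ 2 * (e6 * e9 * e18) ^ 3 * e18"
    unfolding n1 by (simp add: power_mult_distrib mult_ac power_numeral_reduce)
  also have "\<dots> = (norm3 w e1 ^ 2 * (e6 * e9 * e18) ^ 3) * (e9 ^ 2 * e18)"
    by (simp add: power_mult_distrib mult_ac)
  also have "\<dots> = (norm3 w e2 * e18) * e9 ^ 2 * ((e6 * e9 ^ 3) ^ 3 + fps_X ^ 3 * (- 2 * (e3 * e18 ^ 3)) ^ 3)"
    unfolding p by (simp only: mult_ac)
  also have "\<dots> = (e6 ^ 3 * e9 ^ 2) * (e6 * (e6 ^ 3 * e9 ^ 9 - 8 * fps_X ^ 3 * (e3 ^ 3 * e18 ^ 9)))"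
    unfolding n2 by (simp add: power_mult_distrib mult_ac power_numeral_reduce)
  finally show "eul 3 ^ 8 * eul 9 * eul 18 ^ 4 = eul 6 * (eul 6 ^ 3 * eul 9 ^ 9 - 8 * fps_X ^ 3 * (eul 3 ^ 3 * (eul 18 ^ 9 :: 'a fps)))"
    using nz by (simp add: e[symmetric])
qed

lemma fps_compose_X_power_inj:
  fixes f g :: "'a::field fps"
  assumes "f oo fps_X ^ c = g oo fps_X ^ c" "c > 0"
  shows "f = g"
proof -
  have "(f - g) oo fps_X ^ c = 0" using assms by (simp add: fps_compose_sub_distrib)
  then show ?thesis using assms(2) by (subst (asm) fps_compose_eq_0_iff) auto
qed

text \<open>Everything in \<open>level6_cubed\<close> is a series in q^3, and the substitution of
  q^3 for q is injective.\<close>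

lemma level6_field:
  fixes w :: "'a::field_char_0"
  assumes w: "w ^ 2 = - 1 - w" "w ^ 3 = 1"
  shows "eul 2 ^ 8 * eul 3 ^ 4 * eul 6 = eul 1 * (eul 2 ^ 3 * eul 3 ^ 9 + fps_X * (eul 1 ^ 3 * (eul 6 ^ 9 :: 'a fps)))"
    and "eul 1 ^ 8 * eul 3 * eul 6 ^ 4 = eul 2 * (eul 2 ^ 3 * eul 3 ^ 9 - 8 * fps_X * (eul 1 ^ 3 * (eul 6 ^ 9 :: 'a fps)))"
proof -
  have d: "eul 1 oo fps_X ^ 3 = (eul 3 :: 'a fps)" "eul 2 oo fps_X ^ 3 = (eul 6 :: 'a fps)"
    "eul 3 oo fps_X ^ 3 = (eul 9 :: 'a fps)" "eul 6 oo fps_X ^ 3 = (eul 18 :: 'a fps)"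
    using eul_dilate[of 1 3, where 'a='a] eul_dilate[of 2 3, where 'a='a] eul_dilate[of 3 3, where 'a='a] eul_dilate[of 6 3, where 'a='a] by simp_all
  have e8: "(8 :: 'a fps) oo fps_X ^ 3 = 8" by (simp add: numeral_fps_const)
  note s = fps_compose_mult_distrib fps_compose_add_distrib fps_compose_sub_distrib fps_compose_power[symmetric] d fps_X_fps_compose_startby0 e8
  show "eul 2 ^ 8 * eul 3 ^ 4 * eul 6 = eul 1 * (eul 2 ^ 3 * eul 3 ^ 9 + fps_X * (eul 1 ^ 3 * (eul 6 ^ 9 :: 'a fps)))"
    by (rule fps_compose_X_power_inj[of _ 3]) (use level6_cubed(1)[OF w] in \<open>simp_all add: s del: One_nat_def\<close>)
  show "eul 1 ^ 8 * eul 3 * eul 6 ^ 4 = eul 2 * (eul 2 ^ 3 * eul 3 ^ 9 - 8 * fps_X * (eul 1 ^ 3 * (eul 6 ^ 9 :: 'a fps)))"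
    by (rule fps_compose_X_power_inj[of _ 3]) (use level6_cubed(2)[OF w] in \<open>simp_all add: s del: One_nat_def\<close>)
qed

section \<open>Descent from complex to rational coefficients\<close>

definition complex_fps :: "rat fps \<Rightarrow> complex fps" where
  "complex_fps f = Abs_fps (\<lambda>n. of_rat (f $ n))"

lemma complex_fps_nth [simp]: "complex_fps f $ n = of_rat (f $ n)"
  by (simp add: complex_fps_def)

lemma complex_fps_mult: "complex_fps (f * g) = complex_fps f * complex_fps g"
  by (rule fps_ext) (simp add: fps_mult_nth of_rat_sum of_rat_mult)

lemma complex_fps_add: "complex_fps (f + g) = complex_fps f + complex_fps g"
  and complex_fps_diff: "complex_fps (f - g) = complex_fps f - complex_fps g"
  by (rule fps_ext, simp add: of_rat_add of_rat_diff)+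

lemma complex_fps_1 [simp]: "complex_fps 1 = 1"
  and complex_fps_X [simp]: "complex_fps fps_X = fps_X"
  by (rule fps_ext, simp)+

lemma complex_fps_numeral [simp]: "complex_fps (numeral n) = numeral n"
  by (rule fps_ext) (simp add: numeral_fps_const)

lemma complex_fps_power: "complex_fps (f ^ n) = complex_fps f ^ n"
  by (induction n) (simp_all add: complex_fps_mult)

lemma complex_fps_eul: "complex_fps (eul k) = eul k"
proof -
  have "complex_fps (fprod k n) = fprod k n" for n
    by (induction n) (simp_all only: fprod_0 fprod_Suc complex_fps_mult complex_fps_diff complex_fps_1 complex_fps_power complex_fps_X)
  from this[THEN arg_cong, of "\<lambda>f. f $ n" for n] show ?thesis
    by (intro fps_ext) (simp add: eul_def)
qed

lemma complex_fps_eq_iff: "complex_fps f = complex_fps g \<longleftrightarrow> f = g"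
  by (simp add: fps_eq_iff)

lemma level6:
  "eul 2 ^ 8 * eul 3 ^ 4 * eul 6 = eul 1 * (eul 2 ^ 3 * eul 3 ^ 9 + fps_X * (eul 1 ^ 3 * (eul 6 ^ 9 :: rat fps)))"
  "eul 1 ^ 8 * eul 3 * eul 6 ^ 4 = eul 2 * (eul 2 ^ 3 * eul 3 ^ 9 - 8 * fps_X * (eul 1 ^ 3 * (eul 6 ^ 9 :: rat fps)))"
proof -
  define w :: complex where "w = Complex (-1/2) (sqrt 3 / 2)"
  have w: "w ^ 2 = - 1 - w" by (simp add: w_def complex_eq_iff power2_eq_square)
  have "w ^ 3 = w * w ^ 2" by (simp add: power3_eq_cube power2_eq_square)
  also have "\<dots> = 1" unfolding w using w by (simp add: right_diff_distrib power2_eq_square)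
  finally have w3: "w ^ 3 = 1" .
  note s = complex_fps_mult complex_fps_add complex_fps_diff complex_fps_power complex_fps_eul complex_fps_X complex_fps_numeral
  show "eul 2 ^ 8 * eul 3 ^ 4 * eul 6 = eul 1 * (eul 2 ^ 3 * eul 3 ^ 9 + fps_X * (eul 1 ^ 3 * (eul 6 ^ 9 :: rat fps)))"
    by (subst complex_fps_eq_iff[symmetric]) (simp only: s level6_field[OF w w3])
  show "eul 1 ^ 8 * eul 3 * eul 6 ^ 4 = eul 2 * (eul 2 ^ 3 * eul 3 ^ 9 - 8 * fps_X * (eul 1 ^ 3 * (eul 6 ^ 9 :: rat fps)))"
    by (subst complex_fps_eq_iff[symmetric]) (simp only: s level6_field[OF w w3])
qed

section \<open>The modular equation\<close>

lemma U_spec: "f + twist (-1) f = 2 * (U f oo fps_X ^ 2)"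
proof (rule fps_ext)
  fix n
  have "(2 * (U f oo fps_X ^ 2)) $ n = 2 * (U f oo fps_X ^ 2) $ n"
    by (simp add: numeral_fps_const)
  then show "(f + twist (-1) f) $ n = (2 * (U f oo fps_X ^ 2)) $ n"
    by (cases "even n") (auto simp: twist_nth fps_nth_compose_X_power U_def)
qed

lemma U_eqI:
  assumes "f + twist (-1) f = 2 * (g oo fps_X ^ 2)"
  shows "U f = g"
proof -
  have "2 * (U f oo fps_X ^ 2) = 2 * (g oo fps_X ^ 2)" using assms by (simp add: U_spec)
  then have "U f oo fps_X ^ 2 = g oo fps_X ^ 2" by (simp only: mult_cancel_left) simp
  then show ?thesis by (rule fps_compose_X_power_inj) simp
qed

lemma U_diff: "U (f - g) = U f - U g"
  by (rule fps_ext) (simp add: U_def)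

lemma twist_even: "twist (-1) (g oo fps_X ^ 2) = (g oo fps_X ^ 2)"
  by (rule fps_ext) (simp add: twist_nth fps_nth_compose_X_power)

text \<open>Even series are fixed by \<open>twist (-1)\<close>, so \<open>U\<close> is linear over
  them; this turns quadratic equations into recurrences.\<close>

lemma U_mult_even: "U ((g oo fps_X ^ 2) * f) = g * U f"
proof (rule U_eqI)
  have "(g oo fps_X ^ 2) * f + twist (-1) ((g oo fps_X ^ 2) * f) = (g oo fps_X ^ 2) * (f + twist (-1) f)"
    by (simp add: twist_mult twist_even algebra_simps)
  also have "\<dots> = 2 * (g * U f oo fps_X ^ 2)"
    unfolding U_spec by (simp add: fps_compose_mult_distrib mult_ac)
  finally show "(g oo fps_X ^ 2) * f + twist (-1) ((g oo fps_X ^ 2) * f) = 2 * (g * U f oo fps_X ^ 2)" .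
qed

section \<open>Eta quotients for xi and kappa, and conjugation\<close>

lemma Eq_nth_0 [simp]: "k > 0 \<Longrightarrow> Eq k $ 0 = 1"
  by (simp add: Eq_eq_eul)

lemma Eq_nonzero [simp]: "k > 0 \<Longrightarrow> Eq k \<noteq> 0"
  by (simp add: Eq_eq_eul)

lemma fps_divide_mult_unit:
  fixes f g :: "'a::field fps"
  assumes "g $ 0 \<noteq> 0"
  shows "f / g * g = f"
  using assms by (simp add: dvd_div_mult_self unit_imp_dvd fps_is_unit_iff)

lemma xi_mult: "xi * (Eq 1 * Eq 3 ^ 5) = Eq 2 ^ 5 * Eq 6"
  unfolding xi_def by (rule fps_divide_mult_unit) simp

lemma xi_nth_0 [simp]: "xi $ 0 = 1"
  using xi_mult[THEN arg_cong, of "\<lambda>f. f $ 0"] by (simp add: fps_power_zeroth)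

lemma gam_mult: "k > 0 \<Longrightarrow> gam k * Eq (3 * k) ^ 15 = Eq k ^ 5 * Eq (2 * k) ^ 5 * Eq (6 * k) ^ 5"
  unfolding gam_def by (rule fps_divide_mult_unit) simp

lemma kappa_mult: "kappa * (Eq 1 ^ 5 * Eq 6 ^ 35) = Eq 2 ^ 5 * Eq 4 ^ 10 * Eq 12 ^ 10 * Eq 3 ^ 15"
proof -
  have g1: "gam 1 * Eq 3 ^ 15 = Eq 1 ^ 5 * Eq 2 ^ 5 * Eq 6 ^ 5"
    using gam_mult[of 1] by simp
  have g2: "gam 2 * Eq 6 ^ 15 = Eq 2 ^ 5 * Eq 4 ^ 5 * Eq 12 ^ 5"
    using gam_mult[of 2] by simp
  have "gam 1 $ 0 = 1" using g1[THEN arg_cong, of "\<lambda>f. f $ 0"] by (simp add: fps_power_zeroth)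
  then have k: "kappa * gam 1 = gam 2 ^ 2"
    unfolding kappa_def by (intro fps_divide_mult_unit) simp
  have "Eq 2 ^ 5 * (kappa * (Eq 1 ^ 5 * Eq 6 ^ 35)) = kappa * (Eq 1 ^ 5 * Eq 2 ^ 5 * Eq 6 ^ 5) * Eq 6 ^ 30"
    by (simp add: mult_ac flip: power_add)
  also have "\<dots> = (kappa * gam 1) * Eq 3 ^ 15 * Eq 6 ^ 30"
    unfolding g1[symmetric] by (simp only: mult_ac)
  also have "\<dots> = (gam 2 * Eq 6 ^ 15) ^ 2 * Eq 3 ^ 15"
    unfolding k by (simp add: power_mult_distrib mult_ac flip: power_mult)
  also have "\<dots> = Eq 2 ^ 5 * (Eq 2 ^ 5 * Eq 4 ^ 10 * Eq 12 ^ 10 * Eq 3 ^ 15)"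
    unfolding g2 by (simp add: power_mult_distrib mult_ac power_add flip: power_mult)
  finally show ?thesis by simp
qed

lemma xi_minus_one: "(xi - 1) * (Eq 2 ^ 3 * Eq 3 ^ 9) = fps_X * (Eq 1 ^ 3 * Eq 6 ^ 9)"
proof -
  have "Eq 1 * (xi * (Eq 2 ^ 3 * Eq 3 ^ 9)) = (xi * (Eq 1 * Eq 3 ^ 5)) * (Eq 2 ^ 3 * Eq 3 ^ 4)"
    by (simp add: mult_ac power_numeral_reduce)
  also have "\<dots> = Eq 1 * (Eq 2 ^ 3 * Eq 3 ^ 9 + fps_X * (Eq 1 ^ 3 * Eq 6 ^ 9))"
    unfolding xi_mult using level6(1) by (simp add: Eq_eq_eul mult_ac power_numeral_reduce)
  finally show ?thesis by (simp add: left_diff_distrib)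
qed

lemma nine_minus_eight_xi: "(9 - 8 * xi) * (Eq 2 ^ 4 * Eq 3 ^ 8) = Eq 1 ^ 8 * Eq 6 ^ 4"
proof -
  have "Eq 3 * ((9 - 8 * xi) * (Eq 2 ^ 4 * Eq 3 ^ 8)) = Eq 2 * (Eq 2 ^ 3 * Eq 3 ^ 9 - 8 * ((xi - 1) * (Eq 2 ^ 3 * Eq 3 ^ 9)))"
    by (simp add: algebra_simps power_numeral_reduce)
  also have "\<dots> = Eq 3 * (Eq 1 ^ 8 * Eq 6 ^ 4)"
    unfolding xi_minus_one using level6(2) by (simp add: Eq_eq_eul mult_ac)
  finally show ?thesis by simp
qed

abbreviation xi2 :: "rat fps" where "xi2 \<equiv> xi oo fps_X ^ 2"
abbreviation xi' :: "rat fps" where "xi' \<equiv> twist (-1) xi"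

lemma Eq_dilate_2:
  "Eq 1 oo fps_X ^ 2 = Eq 2" "Eq 2 oo fps_X ^ 2 = Eq 4" "Eq 3 oo fps_X ^ 2 = Eq 6" "Eq 6 oo fps_X ^ 2 = Eq 12"
  using eul_dilate[of 1 2] eul_dilate[of 2 2] eul_dilate[of 3 2] eul_dilate[of 6 2] by (simp_all add: Eq_eq_eul)

lemma fps_compose_numeral [simp]: "(numeral n :: rat fps) oo g = numeral n"
  by (simp add: numeral_fps_const)

lemmas dilate_simps = fps_compose_mult_distrib fps_compose_add_distrib fps_compose_sub_distrib
  fps_compose_power[symmetric] Eq_dilate_2 fps_X_fps_compose_startby0 fps_compose_numeral fps_compose_1

lemma xi2_mult: "xi2 * (Eq 2 * Eq 6 ^ 5) = Eq 4 ^ 5 * Eq 12"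
  using xi_mult[THEN arg_cong, of "\<lambda>f. f oo fps_X ^ 2"] by (simp add: dilate_simps del: One_nat_def)

lemma xi2_minus_one: "(xi2 - 1) * (Eq 4 ^ 3 * Eq 6 ^ 9) = fps_X ^ 2 * (Eq 2 ^ 3 * Eq 12 ^ 9)"
  using xi_minus_one[THEN arg_cong, of "\<lambda>f. f oo fps_X ^ 2"] by (simp add: dilate_simps del: One_nat_def)

lemma nine_minus_eight_xi2: "(9 - 8 * xi2) * (Eq 4 ^ 4 * Eq 6 ^ 8) = Eq 2 ^ 8 * Eq 12 ^ 4"
  using nine_minus_eight_xi[THEN arg_cong, of "\<lambda>f. f oo fps_X ^ 2"] by (simp add: dilate_simps del: One_nat_def)

lemma twist_Eq_even: "twist (-1) (Eq 2) = Eq 2" "twist (-1) (Eq 6) = Eq 6"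
  unfolding Eq_eq_eul by (intro twist_eul; simp)+

lemma twist_Eq_odd:
  "Eq 1 * twist (-1) (Eq 1) * Eq 4 = Eq 2 ^ 3"
  "Eq 3 * twist (-1) (Eq 3) * Eq 12 = Eq 6 ^ 3"
  using eul_twist_minus_one[of 1, where 'a=rat] eul_twist_minus_one[of 3, where 'a=rat] by (simp_all add: Eq_eq_eul)

lemma twist_minus_one_X: "twist (-1) fps_X = - (fps_X :: 'a::field fps)"
  by (rule fps_ext) (simp add: twist_nth fps_X_def)

lemma xi'_mult: "xi' * (twist (-1) (Eq 1) * twist (-1) (Eq 3) ^ 5) = Eq 2 ^ 5 * Eq 6"
  using xi_mult[THEN arg_cong, of "twist (-1)"] by (simp only: twist_mult twist_power twist_Eq_even)

lemma xi'_minus_one: "(xi' - 1) * (Eq 2 ^ 3 * twist (-1) (Eq 3) ^ 9) = - fps_X * (twist (-1) (Eq 1) ^ 3 * Eq 6 ^ 9)"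
  using xi_minus_one[THEN arg_cong, of "twist (-1)"]
  by (simp only: twist_mult twist_power twist_Eq_even twist_diff twist_1 twist_minus_one_X)

text \<open>The formulas for E(-q) turn the product into an eta quotient in q^2, which splits into
  those of \<open>xi2\<close> and \<open>9 - 8 * xi2\<close>.\<close>

lemma xi_xi'_prod: "xi * xi' = xi2 * (9 - 8 * xi2)"
proof -
  define e1 e2 e3 e4 e6 e12 f1 f3 where e: "e1 = Eq 1" "e2 = Eq 2" "e3 = Eq 3" "e4 = Eq 4" "e6 = Eq 6" "e12 = Eq 12"
    "f1 = twist (-1) (Eq 1)" "f3 = twist (-1) (Eq 3)"
  have nz: "e2 \<noteq> 0" "e4 \<noteq> 0" "e6 \<noteq> 0" by (simp_all add: e)
  have "(e2 ^ 3 * e4 ^ 4 * e6 ^ 15) * (xi * xi') = xi * xi' * (e1 * f1 * e4) * (e3 * f3 * e12) ^ 5 * e4 ^ 4"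
    unfolding twist_Eq_odd[folded e] by (simp add: mult_ac flip: power_mult)
  also have "\<dots> = (xi * (e1 * e3 ^ 5)) * (xi' * (f1 * f3 ^ 5)) * (e4 ^ 5 * e12 ^ 5)"
    by (simp add: power_mult_distrib mult_ac power_numeral_reduce)
  also have "\<dots> = (e4 ^ 5 * e12) * (e2 ^ 8 * e12 ^ 4) * (e2 ^ 2 * e6 ^ 2)"
    unfolding xi_mult[folded e] xi'_mult[folded e] by (simp add: mult_ac power_numeral_reduce)
  also have "\<dots> = (e2 ^ 3 * e4 ^ 4 * e6 ^ 15) * (xi2 * (9 - 8 * xi2))"
    unfolding xi2_mult[folded e, symmetric] nine_minus_eight_xi2[folded e, symmetric] by (simp add: mult_ac power_numeral_reduce)
  finally show ?thesis using nz by simp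
qed

text \<open>The product of the conjugates of \<open>xi - 1\<close> is computed first; its minus sign
  comes from the factor \<open>fps_X\<close>, which is odd. Expanding gives the sum from the known
  product.\<close>

lemma xi_xi'_sum: "xi + xi' = 10 * xi2 - 8 * xi2 ^ 2"
proof -
  define e1 e2 e3 e4 e6 e12 f1 f3 where e: "e1 = Eq 1" "e2 = Eq 2" "e3 = Eq 3" "e4 = Eq 4" "e6 = Eq 6" "e12 = Eq 12"
    "f1 = twist (-1) (Eq 1)" "f3 = twist (-1) (Eq 3)"
  have nz: "e2 \<noteq> 0" "e4 \<noteq> 0" "e6 \<noteq> 0" by (simp_all add: e)
  have "(e2 ^ 6 * e4 ^ 3 * e6 ^ 27) * ((xi - 1) * (xi' - 1)) = ((xi - 1) * (e2 ^ 3 * e3 ^ 9)) * ((xi' - 1) * (e2 ^ 3 * f3 ^ 9)) * (e4 ^ 3 * e12 ^ 9)"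
    using arg_cong[OF twist_Eq_odd(2)[folded e], of "\<lambda>y. y ^ 9"]
    by (simp add: power_mult_distrib flip: power_mult) (simp add: mult_ac power_numeral_reduce)
  also have "\<dots> = - (fps_X ^ 2 * (e1 * f1 * e4) ^ 3 * e6 ^ 18 * e12 ^ 9)"
    unfolding xi_minus_one[folded e] xi'_minus_one[folded e] by (simp add: power_mult_distrib mult_ac power_numeral_reduce)
  also have "\<dots> = - (fps_X ^ 2 * (e2 ^ 3 * e12 ^ 9)) * (e2 ^ 6 * e6 ^ 18)"
    unfolding twist_Eq_odd[folded e] by (simp add: mult_ac power_numeral_reduce)
  also have "\<dots> = (e2 ^ 6 * e4 ^ 3 * e6 ^ 27) * (1 - xi2)"
    unfolding xi2_minus_one[folded e, symmetric] by (simp add: algebra_simps power_numeral_reduce)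
  finally have "(xi - 1) * (xi' - 1) = 1 - xi2" using nz by simp
  then have "xi + xi' = xi * xi' + xi2" by (simp add: algebra_simps)
  then show ?thesis by (simp add: xi_xi'_prod algebra_simps power2_eq_square)
qed

lemma xi_square: "xi ^ 2 = (10 * xi2 - 8 * xi2 ^ 2) * xi - xi2 * (9 - 8 * xi2)"
  unfolding xi_xi'_sum[symmetric] xi_xi'_prod[symmetric] by (simp add: algebra_simps power2_eq_square)

text \<open>The constant coefficient 2 of \<open>f + g\<close> excludes
  \<open>f = - g\<close>.\<close>

lemma fps_square_root_unique:
  fixes f g :: "rat fps"
  assumes "f ^ 2 = g ^ 2" "f $ 0 = 1" "g $ 0 = 1"
  shows "f = g"
proof -
  have "(f + g) $ 0 \<noteq> 0" using assms by simp
  then have "f + g \<noteq> 0" by force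
  then show ?thesis using assms(1) by (auto simp: power2_eq_iff)
qed

lemma fps_cube_root_unique:
  fixes f g :: "rat fps"
  assumes "f ^ 3 = g ^ 3" "f $ 0 = 1" "g $ 0 = 1"
  shows "f = g"
proof -
  have "(f ^ 2 + f * g + g ^ 2) $ 0 \<noteq> 0" using assms by (simp add: fps_power_zeroth)
  then have "f ^ 2 + f * g + g ^ 2 \<noteq> 0" by force
  moreover have "(f - g) * (f ^ 2 + f * g + g ^ 2) = 0"
    using assms(1) by (simp add: algebra_simps power2_eq_square power3_eq_cube)
  ultimately show ?thesis by simp
qed

section \<open>The parametrization by an eta quotient of level 12\<close>

text \<open>The series \<open>h\<close> above, equal to \<open>E\<^sub>2 E\<^sub>3\<^sup>3 E\<^sub>4\<^sup>2 E\<^sub>1\<^sub>2\<^sup>2 / (E\<^sub>1 E\<^sub>6\<^sup>7)\<close>. The formula solves the modular equation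
  \<open>\<xi> = x (5 - 4x) + (4x - 3) w\<close>, \<open>w\<^sup>2 = x\<^sup>2 - x\<close>, for \<open>h = x + w\<close>.\<close>

definition eta12 :: "rat fps" where
  "eta12 = (xi + 8 * xi2 ^ 2 - 8 * xi2) / (4 * xi2 - 3)"

lemma eta12_mult: "eta12 * (4 * xi2 - 3) = xi + 8 * xi2 ^ 2 - 8 * xi2"
  unfolding eta12_def by (rule fps_divide_mult_unit) (simp add: numeral_fps_const)

lemma eta12_nth_0: "eta12 $ 0 = 1"
  using eta12_mult[THEN arg_cong, of "\<lambda>f. f $ 0"] by (simp add: numeral_fps_const fps_power_zeroth)

lemma four_xi2_minus_3_nonzero: "4 * xi2 - 3 \<noteq> 0"
proof -
  have "(4 * xi2 - 3) $ 0 \<noteq> 0" by (simp add: numeral_fps_const)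
  then show ?thesis by force
qed

text \<open>Completing the square: \<open>u * (eta12 - x)\<close> is \<open>xi\<close> minus half
  its trace, so its square is a quarter of the discriminant,
  \<open>u ^ 2 * (x ^ 2 - x)\<close>.\<close>

lemma eta12_square: "(2 * eta12 - 1) * xi2 = eta12 ^ 2"
proof -
  define x u where "x = xi2" and "u = 4 * x - 3"
  have u: "eta12 * u = xi + 8 * x ^ 2 - 8 * x" using eta12_mult by (simp add: u_def x_def)
  have "u * (eta12 - x) = xi - 5 * x + 4 * x ^ 2"
    unfolding right_diff_distrib mult.commute[of u eta12] u by (simp add: u_def algebra_simps power2_eq_square)
  then have "(u * (eta12 - x)) ^ 2 = (xi - 5 * x + 4 * x ^ 2) ^ 2" by simp
  also have "\<dots> = xi ^ 2 + 2 * (4 * x ^ 2 - 5 * x) * xi + (4 * x ^ 2 - 5 * x) ^ 2"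
    by (simp add: algebra_simps power2_eq_square)
  also have "\<dots> = u ^ 2 * (x ^ 2 - x)"
    unfolding xi_square x_def[symmetric] u_def by (simp add: algebra_simps power2_eq_square)
  finally have "u ^ 2 * (eta12 - x) ^ 2 = u ^ 2 * (x ^ 2 - x)" by (simp add: power_mult_distrib)
  moreover have "u \<noteq> 0" using four_xi2_minus_3_nonzero by (simp add: u_def x_def)
  ultimately have "(eta12 - x) ^ 2 = x ^ 2 - x" by simp
  then show ?thesis unfolding x_def[symmetric] by (simp add: algebra_simps power2_eq_square)
qed

text \<open>With \<open>y = 2h - 1\<close> one has \<open>x = h\<^sup>2/y\<close>, \<open>x - 1 = (h - 1)\<^sup>2/y\<close> and \<open>\<xi> - 1 = (h - 1)/y\<^sup>2\<close>, so \<open>y\<^sup>3 = (x - 1)/(\<xi> - 1)\<^sup>2\<close>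
  is an eta quotient, in fact the cube of one.\<close>

lemma two_eta12_minus_1_mult: "(2 * eta12 - 1) * (Eq 1 ^ 2 * Eq 4 * Eq 6 ^ 9) = Eq 2 ^ 3 * Eq 12 ^ 3 * Eq 3 ^ 6"
proof -
  define e1 e2 e3 e4 e6 e12 where e: "e1 = Eq 1" "e2 = Eq 2" "e3 = Eq 3" "e4 = Eq 4" "e6 = Eq 6" "e12 = Eq 12"
  have nz: "e2 \<noteq> 0" "e4 \<noteq> 0" "e6 \<noteq> 0" by (simp_all add: e)
  define x h where "x = xi2" and "h = eta12"
  define y where "y = 2 * h - 1"
  have yx: "y * x = h ^ 2" using eta12_square by (simp add: x_def y_def h_def)
  have xi: "xi = h * (4 * x - 3) - 8 * x ^ 2 + 8 * x"
    using eta12_mult by (simp add: x_def h_def)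
  \<comment> \<open>The powers of \<open>y\<close> are chosen so that \<open>x\<close> occurs only
    as \<open>y * x = h ^ 2\<close>; what remains is a polynomial in \<open>h\<close>.\<close>
  have "y ^ 2 * (xi - 1) = (4 * y * (y * x) - 3 * y ^ 2) * h - 8 * (y * x) ^ 2 + 8 * y * (y * x) - y ^ 2"
    unfolding xi by (simp add: algebra_simps power2_eq_square)
  also have "\<dots> = h - 1"
    unfolding yx unfolding y_def by (simp add: algebra_simps power2_eq_square)
  finally have 1: "y ^ 2 * (xi - 1) = h - 1" .
  have "y * (x - 1) = (h - 1) ^ 2"
    using yx by (simp add: y_def algebra_simps power2_eq_square)
  moreover have "y * (y ^ 3 * (xi - 1) ^ 2) = (y ^ 2 * (xi - 1)) ^ 2"
    by (simp add: power_mult_distrib power2_eq_square power3_eq_cube mult_ac)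
  ultimately have "y * (y ^ 3 * (xi - 1) ^ 2) = y * (x - 1)"
    by (simp only: 1)
  moreover have "y $ 0 = 1" by (simp add: y_def h_def eta12_nth_0 numeral_fps_const)
  then have "y \<noteq> 0" by force
  ultimately have y3: "y ^ 3 * (xi - 1) ^ 2 = x - 1" by simp
  have "fps_X ^ 2 * (y * (e1 ^ 2 * e4 * e6 ^ 9)) ^ 3 = y ^ 3 * (fps_X * (e1 ^ 3 * e6 ^ 9)) ^ 2 * (e4 ^ 3 * e6 ^ 9)"
    by (simp add: power_mult_distrib mult_ac flip: power_mult)
  also have "\<dots> = (y ^ 3 * (xi - 1) ^ 2) * (e4 ^ 3 * e6 ^ 9) * (e2 ^ 6 * e3 ^ 18)"
    unfolding xi_minus_one[folded e, symmetric] by (simp add: power_mult_distrib mult_ac flip: power_mult)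
  also have "\<dots> = (fps_X ^ 2 * (e2 ^ 3 * e12 ^ 9)) * (e2 ^ 6 * e3 ^ 18)"
    unfolding y3 using xi2_minus_one[folded e] by (simp add: x_def)
  also have "\<dots> = fps_X ^ 2 * (e2 ^ 3 * e12 ^ 3 * e3 ^ 6) ^ 3"
    by (simp add: power_mult_distrib mult_ac flip: power_mult)
  finally have "(y * (e1 ^ 2 * e4 * e6 ^ 9)) ^ 3 = (e2 ^ 3 * e12 ^ 3 * e3 ^ 6) ^ 3" by simp
  then have "y * (e1 ^ 2 * e4 * e6 ^ 9) = e2 ^ 3 * e12 ^ 3 * e3 ^ 6"
    by (rule fps_cube_root_unique) (simp_all add: e \<open>y $ 0 = 1\<close> fps_power_zeroth)
  then show ?thesis by (simp only: e y_def h_def)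
qed

text \<open>By \<open>eta12_square\<close>, the square of \<open>eta12\<close> is a product of two
  known eta quotients. Its root with constant coefficient 1 is an eta quotient whose fifth power is
  that of \<open>kappa\<close>.\<close>

lemma kappa_eq: "kappa = eta12 ^ 5"
proof -
  define e1 e2 e3 e4 e6 e12 where e: "e1 = Eq 1" "e2 = Eq 2" "e3 = Eq 3" "e4 = Eq 4" "e6 = Eq 6" "e12 = Eq 12"
  have nz: "e1 \<noteq> 0" "e2 \<noteq> 0" "e4 \<noteq> 0" "e6 \<noteq> 0" by (simp_all add: e)
  have "(e2 * e4) * (eta12 * (e1 * e6 ^ 7)) ^ 2 = (eta12 ^ 2) * (e1 ^ 2 * e2 * e4 * e6 ^ 14)"
    by (simp add: power_mult_distrib mult_ac flip: power_mult)
  also have "\<dots> = ((2 * eta12 - 1) * (e1 ^ 2 * e4 * e6 ^ 9)) * (xi2 * (e2 * e6 ^ 5))"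
    unfolding eta12_square[symmetric] by (simp add: mult_ac power_numeral_reduce)
  also have "\<dots> = (e2 * e4) * (e2 * e3 ^ 3 * e4 ^ 2 * e12 ^ 2) ^ 2"
    unfolding two_eta12_minus_1_mult[folded e] xi2_mult[folded e]
    by (simp add: power_mult_distrib mult_ac flip: power_mult) (simp add: mult_ac power_numeral_reduce)
  finally have "(eta12 * (e1 * e6 ^ 7)) ^ 2 = (e2 * e3 ^ 3 * e4 ^ 2 * e12 ^ 2) ^ 2" using nz by simp
  then have h: "eta12 * (e1 * e6 ^ 7) = e2 * e3 ^ 3 * e4 ^ 2 * e12 ^ 2"
    by (rule fps_square_root_unique) (simp_all add: e eta12_nth_0 fps_power_zeroth)
  have "eta12 ^ 5 * (e1 ^ 5 * e6 ^ 35) = (eta12 * (e1 * e6 ^ 7)) ^ 5"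
    by (simp add: power_mult_distrib mult_ac flip: power_mult)
  also have "\<dots> = kappa * (e1 ^ 5 * e6 ^ 35)"
    unfolding h kappa_mult[folded e] by (simp add: power_mult_distrib mult_ac flip: power_mult)
  finally show ?thesis using nz by simp
qed

text \<open>In the defining fraction only \<open>xi\<close> changes under conjugation, so the trace
  of \<open>xi\<close> suffices.\<close>

lemma eta12_conj_sum: "eta12 + twist (-1) eta12 = 2 * xi2"
proof -
  define x u where "x = xi2" and "u = 4 * x - 3"
  have h: "eta12 * u = xi + 8 * x ^ 2 - 8 * x"
    using eta12_mult by (simp add: u_def x_def)
  have x: "twist (-1) x = x" by (simp add: x_def twist_even)
  have "twist (-1) eta12 * u = xi' + 8 * x ^ 2 - 8 * x"
    using h[THEN arg_cong, of "twist (-1)"]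
    by (simp add: twist_mult twist_diff twist_add twist_power x u_def)
  then have "(eta12 + twist (-1) eta12) * u = (xi + xi') + 16 * x ^ 2 - 16 * x"
    using h by (simp add: distrib_right)
  also have "\<dots> = 2 * x * u"
    unfolding xi_xi'_sum x_def[symmetric] u_def by (simp add: algebra_simps power2_eq_square)
  finally show ?thesis
    using four_xi2_minus_3_nonzero by (simp add: u_def x_def)
qed

lemma eta12_conj_prod: "eta12 * twist (-1) eta12 = xi2"
proof -
  have t: "twist (-1) eta12 = 2 * xi2 - eta12"
    using eta12_conj_sum by (simp add: algebra_simps)
  have "eta12 * (2 * xi2 - eta12) = 2 * eta12 * xi2 - eta12 ^ 2"
    by (simp only: right_diff_distrib power2_eq_square mult_ac)
  also have "\<dots> = xi2"
    unfolding eta12_square[symmetric] by (simp only: left_diff_distrib) simp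
  finally show ?thesis by (simp only: t)
qed

section \<open>Recurrences and initial values for zeta\<close>

lemma U_quadratic_recurrence:
  assumes "f ^ 2 = (s oo fps_X ^ 2) * f - (p oo fps_X ^ 2)"
  shows "U (g * f ^ (n + 2)) = s * U (g * f ^ (n + 1)) - p * U (g * f ^ n)"
proof -
  have "g * f ^ (n + 2) = (s oo fps_X ^ 2) * (g * f ^ (n + 1)) - (p oo fps_X ^ 2) * (g * f ^ n)"
    unfolding power_add assms by (simp add: algebra_simps)
  then show ?thesis by (simp add: U_diff U_mult_even)
qed

lemma U_1: "U 1 = 1"
  by (rule U_eqI) simp

lemma U_eta12: "U eta12 = xi"
  by (rule U_eqI) (simp add: eta12_conj_sum)

lemma U_eta12_power_add_2: "U (eta12 ^ (n + 2)) = 2 * xi * U (eta12 ^ (n + 1)) - xi * U (eta12 ^ n)"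
proof -
  have "eta12 ^ 2 = (2 * xi oo fps_X ^ 2) * eta12 - xi2"
    using eta12_square by (simp add: dilate_simps algebra_simps)
  from U_quadratic_recurrence[OF this, of 1] show ?thesis by simp
qed

lemma U_eta12_powers:
  shows U_eta12_5: "U (eta12 ^ 5) = 16 * xi ^ 5 - 20 * xi ^ 4 + 5 * xi ^ 3"
    and U_eta12_6: "U (eta12 ^ 6) = 32 * xi ^ 6 - 48 * xi ^ 5 + 18 * xi ^ 4 - xi ^ 3"
proof -
  note rec = U_eta12_power_add_2
  have nat_1_add_2: "1 + 2 = (3 :: nat)" "1 + 1 = (2 :: nat)" by simp_all
  have 2: "U (eta12 ^ 2) = 2 * xi ^ 2 - xi"
    using rec[of 0] by (simp add: U_1 U_eta12 power2_eq_square)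
  have "2 * xi * (2 * xi ^ 2 - xi) - xi * (xi) = 4 * xi ^ 3 - 3 * xi ^ 2"
    by (simp add: algebra_simps power_numeral_reduce)
  then have 3: "U (eta12 ^ 3) = 4 * xi ^ 3 - 3 * xi ^ 2"
    using rec[of 1, unfolded nat_1_add_2] by (simp add: 2 U_eta12)
  have "2 * xi * (4 * xi ^ 3 - 3 * xi ^ 2) - xi * (2 * xi ^ 2 - xi) = 8 * xi ^ 4 - 8 * xi ^ 3 + xi ^ 2"
    by (simp add: algebra_simps power_numeral_reduce)
  then have 4: "U (eta12 ^ 4) = 8 * xi ^ 4 - 8 * xi ^ 3 + xi ^ 2"
    using rec[of 2] by (simp add: 3 2)
  have "2 * xi * (8 * xi ^ 4 - 8 * xi ^ 3 + xi ^ 2) - xi * (4 * xi ^ 3 - 3 * xi ^ 2) = 16 * xi ^ 5 - 20 * xi ^ 4 + 5 * xi ^ 3"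
    by (simp add: algebra_simps power_numeral_reduce)
  then show 5: "U (eta12 ^ 5) = 16 * xi ^ 5 - 20 * xi ^ 4 + 5 * xi ^ 3"
    using rec[of 3] by (simp add: 4 3)
  have "2 * xi * (16 * xi ^ 5 - 20 * xi ^ 4 + 5 * xi ^ 3) - xi * (8 * xi ^ 4 - 8 * xi ^ 3 + xi ^ 2) = 32 * xi ^ 6 - 48 * xi ^ 5 + 18 * xi ^ 4 - xi ^ 3"
    by (simp add: algebra_simps power_numeral_reduce)
  then show "U (eta12 ^ 6) = 32 * xi ^ 6 - 48 * xi ^ 5 + 18 * xi ^ 4 - xi ^ 3"
    using rec[of 4] by (simp add: 5 4)
qed

lemma zeta_0_0: "zeta 0 0 = 1"
  by (simp add: zeta_def U_eqI)

lemma zeta_0_1: "zeta 0 1 = 5 * xi - 4 * xi ^ 2"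
  unfolding zeta_def
proof (rule U_eqI)
  show "kappa ^ 0 * xi ^ 1 + twist (-1) (kappa ^ 0 * xi ^ 1) = 2 * (5 * xi - 4 * xi ^ 2 oo fps_X ^ 2)"
    using xi_xi'_sum by (simp add: dilate_simps algebra_simps)
qed

lemma zeta_1_0: "zeta 1 0 = 16 * xi ^ 5 - 20 * xi ^ 4 + 5 * xi ^ 3"
  by (simp add: zeta_def kappa_eq U_eta12_5)

text \<open>Since \<open>xi\<close> is linear in \<open>eta12\<close> over the even series,
  \<open>kappa * xi\<close> is a combination of \<open>eta12 ^ 6\<close> and
  \<open>eta12 ^ 5\<close>.\<close>

lemma zeta_1_1: "zeta 1 1 = 16 * xi ^ 5 - 18 * xi ^ 4 + 3 * xi ^ 3"
proof -
  have "xi = (4 * xi2 - 3) * eta12 - (8 * xi2 ^ 2 - 8 * xi2)"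
    using eta12_mult by (simp add: algebra_simps)
  then have "kappa ^ 1 * xi ^ 1 = eta12 ^ 5 * ((4 * xi2 - 3) * eta12 - (8 * xi2 ^ 2 - 8 * xi2))"
    by (simp add: kappa_eq)
  also have "\<dots> = (4 * xi2 - 3) * eta12 ^ 6 - (8 * xi2 ^ 2 - 8 * xi2) * eta12 ^ 5"
    by (simp add: algebra_simps power_numeral_reduce)
  also have "\<dots> = (4 * xi - 3 oo fps_X ^ 2) * eta12 ^ 6 - (8 * xi ^ 2 - 8 * xi oo fps_X ^ 2) * eta12 ^ 5"
    by (simp add: dilate_simps)
  finally have "zeta 1 1 = (4 * xi - 3) * U (eta12 ^ 6) - (8 * xi ^ 2 - 8 * xi) * U (eta12 ^ 5)"
    by (simp add: zeta_def U_diff U_mult_even)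
  then show ?thesis
    unfolding U_eta12_5 U_eta12_6 by (simp add: algebra_simps power_numeral_reduce)
qed

lemma zeta_add_2_right: "zeta i (j + 2) = 2 * (5 * xi - 4 * xi ^ 2) * zeta i (j + 1) - xi * (9 - 8 * xi) * zeta i j"
  unfolding zeta_def
proof (rule U_quadratic_recurrence)
  show "xi ^ 2 = (2 * (5 * xi - 4 * xi ^ 2) oo fps_X ^ 2) * xi - (xi * (9 - 8 * xi) oo fps_X ^ 2)"
    using xi_square by (simp add: dilate_simps algebra_simps)
qed

text \<open>The quadratic equation of \<open>kappa\<close> has trace twice the even part of
  \<open>kappa\<close>, known from \<open>U_eta12_5\<close>, and norm
  \<open>xi2 ^ 5\<close>.\<close>

lemma zeta_add_2_left: "zeta (i + 2) j = 2 * (16 * xi ^ 5 - 20 * xi ^ 4 + 5 * xi ^ 3) * zeta (i + 1) j - xi ^ 5 * zeta i j"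
  unfolding zeta_def mult.commute[of "kappa ^ _"]
proof (rule U_quadratic_recurrence)
  have "kappa ^ 2 = (kappa + twist (-1) kappa) * kappa - kappa * twist (-1) kappa"
    by (simp add: algebra_simps power2_eq_square)
  also have "kappa * twist (-1) kappa = xi2 ^ 5"
    by (simp add: kappa_eq twist_power eta12_conj_prod flip: power_mult_distrib)
  also have "kappa + twist (-1) kappa = 2 * (16 * xi ^ 5 - 20 * xi ^ 4 + 5 * xi ^ 3) oo fps_X ^ 2"
    unfolding U_spec kappa_eq U_eta12_5 by (simp add: dilate_simps)
  finally show "kappa ^ 2 = (2 * (16 * xi ^ 5 - 20 * xi ^ 4 + 5 * xi ^ 3) oo fps_X ^ 2) * kappa - (xi ^ 5 oo fps_X ^ 2)"
    by (simp add: dilate_simps)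
qed

section \<open>Lowest coefficients\<close>

lemma poly_at_xi_pCons: "poly_at_xi (pCons a P) = of_int a + xi * poly_at_xi P"
  by (simp add: poly_at_xi_def map_poly_pCons fps_of_int)

lemma poly_at_xi_0 [simp]: "poly_at_xi 0 = 0"
  by (simp add: poly_at_xi_def)

lemma poly_at_xi_1 [simp]: "poly_at_xi 1 = 1"
  by (simp add: one_pCons poly_at_xi_pCons)

lemma poly_at_xi_add: "poly_at_xi (P + Q) = poly_at_xi P + poly_at_xi Q"
proof (induction P arbitrary: Q)
  case (pCons a P)
  show ?case
    by (cases Q) (simp add: poly_at_xi_pCons pCons.IH, simp add: algebra_simps)
qed simp

lemma poly_at_xi_smult: "poly_at_xi (smult c P) = of_int c * poly_at_xi P"
  by (induction P) (simp_all add: poly_at_xi_pCons algebra_simps)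

lemma poly_at_xi_diff: "poly_at_xi (P - Q) = poly_at_xi P - poly_at_xi Q"
  using poly_at_xi_add[of "P - Q" Q] by simp

lemma poly_at_xi_mult: "poly_at_xi (P * Q) = poly_at_xi P * poly_at_xi Q"
  by (induction P) (simp_all add: poly_at_xi_pCons poly_at_xi_add poly_at_xi_smult algebra_simps)

lemma poly_at_xi_power: "poly_at_xi (P ^ n) = poly_at_xi P ^ n"
  by (induction n) (simp_all add: poly_at_xi_mult)

lemma poly_at_xi_nth_0: "poly_at_xi P $ 0 = of_int (poly P 1)"
  by (induction P) (simp_all add: poly_at_xi_pCons of_int_add)

text \<open>Since \<open>\<xi> = 1 + q + \<dots>\<close>, splitting off all factors \<open>X - 1\<close> leaves a polynomial whose value at \<open>\<xi>\<close> has nonzero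
  constant coefficient.\<close>

lemma poly_at_xi_eq_0_iff: "poly_at_xi P = 0 \<longleftrightarrow> P = 0"
proof
  assume P: "poly_at_xi P = 0"
  show "P = 0"
  proof (rule ccontr)
    assume "P \<noteq> 0"
    then obtain Q where Q: "P = [:-1, 1:] ^ order 1 P * Q" "\<not> [:-1, 1:] dvd Q"
      using order_decomp[of P 1] by auto
    have "poly_at_xi Q $ 0 \<noteq> 0"
      using Q(2) by (simp add: poly_at_xi_nth_0 poly_eq_0_iff_dvd)
    then have "poly_at_xi Q \<noteq> 0" by force
    moreover have "(xi - 1) * (Eq 2 ^ 3 * Eq 3 ^ 9) \<noteq> 0"
      unfolding xi_minus_one by simp
    then have "poly_at_xi [:-1, 1:] \<noteq> 0" by (simp add: poly_at_xi_pCons)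
    ultimately have "poly_at_xi P \<noteq> 0"
      by (subst Q(1)) (simp add: poly_at_xi_mult poly_at_xi_power)
    then show False using P by simp
  qed
qed simp

lemma poly_at_xi_inject: "poly_at_xi P = poly_at_xi Q \<longleftrightarrow> P = Q"
  using poly_at_xi_eq_0_iff[of "P - Q"] by (simp add: poly_at_xi_diff)

text \<open>The polynomial is kept as a witness, so that injectivity of \<open>poly_at_xi\<close>
  can later identify it with the one defining \<open>Z\<close>.\<close>

definition odd_lowest :: "nat \<Rightarrow> rat fps \<Rightarrow> bool" where
  "odd_lowest n f \<longleftrightarrow> (\<exists>P. f = poly_at_xi (monom 1 n * P) \<and> odd (poly P 0))"

lemma poly_at_xi_monom: "poly_at_xi (monom 1 n) = xi ^ n"
  by (induction n) (simp_all add: monom_0 monom_Suc poly_at_xi_pCons one_pCons[symmetric])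

lemma odd_lowestI: "f = xi ^ n * poly_at_xi P \<Longrightarrow> odd (poly P 0) \<Longrightarrow> odd_lowest n f"
  by (auto simp: odd_lowest_def poly_at_xi_mult poly_at_xi_monom)

lemma odd_lowestE:
  assumes "odd_lowest n f"
  obtains P where "f = xi ^ n * poly_at_xi P" "odd (poly P 0)"
  using assms by (auto simp: odd_lowest_def poly_at_xi_mult poly_at_xi_monom)

text \<open>The first summand is even and its order is at least \<open>n + k\<close>, so modulo 2
  the coefficient at \<open>n + k\<close> is the product of the constant terms of \<open>B\<close>
  and of the cofactor of \<open>g\<close>.\<close>

lemma odd_lowest_recurrence:
  assumes "odd_lowest m f" "odd_lowest n g" "n + k \<le> m + l" and "odd (poly B 0)"
  shows "odd_lowest (n + k) (2 * (xi ^ l * poly_at_xi A) * f - xi ^ k * poly_at_xi B * g)"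
proof -
  obtain P where P: "f = xi ^ m * poly_at_xi P" using assms(1) by (rule odd_lowestE)
  obtain Q where Q: "g = xi ^ n * poly_at_xi Q" "odd (poly Q 0)" using assms(2) by (rule odd_lowestE)
  obtain r where r: "m + l = n + k + r" using assms(3) le_Suc_ex by blast
  have "xi ^ (m + l) = xi ^ (n + k) * xi ^ r" by (simp add: r power_add)
  then have "2 * (xi ^ l * poly_at_xi A) * f - xi ^ k * poly_at_xi B * g
    = xi ^ (n + k) * poly_at_xi (smult 2 (monom 1 r * A * P) - B * Q)"
    unfolding P Q(1) by (simp add: poly_at_xi_mult poly_at_xi_diff poly_at_xi_smult poly_at_xi_monom power_add algebra_simps)
  then show ?thesis by (rule odd_lowestI) (use assms(4) Q(2) in simp)
qed

lemma odd_lowest_zeta_step_right: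
  assumes "odd_lowest (d i (j + 1)) (zeta i (j + 1))" "odd_lowest (d i j) (zeta i j)"
  shows "odd_lowest (d i (j + 2)) (zeta i (j + 2))"
proof -
  \<comment> \<open>The order condition holds because \<open>d\<close> is monotone in
    \<open>j\<close>.\<close>
  have "odd_lowest (d i j + 1) (2 * (xi ^ 1 * poly_at_xi [:5, -4:]) * zeta i (j + 1) - xi ^ 1 * poly_at_xi [:9, -8:] * zeta i j)"
    using assms by (rule odd_lowest_recurrence) (auto simp: d_def Let_def)
  moreover have "d i (j + 2) = d i j + 1" by (simp add: d_def Let_def)
  moreover have "zeta i (j + 2) = 2 * (xi ^ 1 * poly_at_xi [:5, -4:]) * zeta i (j + 1) - xi ^ 1 * poly_at_xi [:9, -8:] * zeta i j"
    unfolding zeta_add_2_right by (simp add: poly_at_xi_pCons algebra_simps power2_eq_square)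
  ultimately show ?thesis by (simp only:)
qed

lemma odd_lowest_zeta_step_left:
  assumes "odd_lowest (d (i + 1) j) (zeta (i + 1) j)" "odd_lowest (d i j) (zeta i j)"
  shows "odd_lowest (d (i + 2) j) (zeta (i + 2) j)"
proof -
  \<comment> \<open>The order condition asks that \<open>d\<close> grow by at least 2 when
    \<open>i\<close> grows by 1; the increments are 2 or 3.\<close>
  have "odd_lowest (d i j + 5) (2 * (xi ^ 3 * poly_at_xi [:5, -20, 16:]) * zeta (i + 1) j - xi ^ 5 * poly_at_xi 1 * zeta i j)"
    using assms by (rule odd_lowest_recurrence) (auto simp: d_def Let_def)
  moreover have "d (i + 2) j = d i j + 5" by (simp add: d_def Let_def)
  moreover have "zeta (i + 2) j = 2 * (xi ^ 3 * poly_at_xi [:5, -20, 16:]) * zeta (i + 1) j - xi ^ 5 * poly_at_xi 1 * zeta i j"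
    unfolding zeta_add_2_left by (simp add: poly_at_xi_pCons algebra_simps power_numeral_reduce)
  ultimately show ?thesis by (simp only:)
qed

lemma odd_lowest_zeta: "odd_lowest (d i j) (zeta i j)"
proof -
  have base: "odd_lowest (d 0 0) (zeta 0 0)" "odd_lowest (d 0 1) (zeta 0 1)"
    "odd_lowest (d 1 0) (zeta 1 0)" "odd_lowest (d 1 1) (zeta 1 1)"
  proof -
    show "odd_lowest (d 0 0) (zeta 0 0)"
      by (rule odd_lowestI[of _ _ 1]) (simp_all add: d_def zeta_0_0)
    show "odd_lowest (d 0 1) (zeta 0 1)" unfolding zeta_0_1
      by (rule odd_lowestI[of _ _ "[:5, -4:]"]) (simp_all add: d_def poly_at_xi_pCons algebra_simps power_numeral_reduce)
    show "odd_lowest (d 1 0) (zeta 1 0)" unfolding zeta_1_0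
      by (rule odd_lowestI[of _ _ "[:5, -20, 16:]"]) (simp_all add: d_def poly_at_xi_pCons algebra_simps power_numeral_reduce)
    show "odd_lowest (d 1 1) (zeta 1 1)" unfolding zeta_1_1
      by (rule odd_lowestI[of _ _ "[:3, -18, 16:]"]) (simp_all add: d_def poly_at_xi_pCons algebra_simps power_numeral_reduce)
  qed
  have two_step: "Q n" if "Q 0" "Q 1" "\<And>n. Q (n + 1) \<Longrightarrow> Q n \<Longrightarrow> Q (n + 2)" for Q :: "nat \<Rightarrow> bool" and n
    using that by (induction n rule: induct_nat_012) simp_all
  \<comment> \<open>First all \<open>j\<close> in the rows \<open>i = 0\<close> and
    \<open>i = 1\<close>; these are then the two starting values for each column.\<close>
  have "odd_lowest (d 0 j) (zeta 0 j)" "odd_lowest (d 1 j) (zeta 1 j)"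
    for j
    using two_step[of "\<lambda>j. odd_lowest (d 0 j) (zeta 0 j)" j] two_step[of "\<lambda>j. odd_lowest (d 1 j) (zeta 1 j)" j]
      base odd_lowest_zeta_step_right by blast+
  then show ?thesis
    using two_step[of "\<lambda>i. odd_lowest (d i j) (zeta i j)" i] odd_lowest_zeta_step_left by blast
qed

theorem theorem3p1:
  fixes i j :: nat
  assumes "\<exists>P. zeta i j = poly_at_xi P"
  shows "(\<forall>m < d i j. Z i j m = 0) \<and> odd (Z i j (d i j))"
proof -
  obtain P where P: "zeta i j = poly_at_xi (monom 1 (d i j) * P)" "odd (poly P 0)"
    using odd_lowest_zeta[of i j] by (auto simp: odd_lowest_def)
  \<comment> \<open>No nonzero integer polynomial vanishes at \<open>xi\<close>, so the witness is
    the polynomial picked out by the description.\<close>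
  have "(THE P. zeta i j = poly_at_xi P) = monom 1 (d i j) * P"
    by (rule the_equality) (simp_all add: P(1) poly_at_xi_inject)
  then have "Z i j m = (if m < d i j then 0 else coeff P (m - d i j))" for m
    by (simp add: Z_def coeff_monom_mult)
  then show ?thesis using P(2) by (simp add: poly_0_coeff_0)
qed

end
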